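(* Let $X$ and $J$ be finite and let $f\in\mathcal L(X,J)$ be a generative formula. Then there is a continuum of distinct cells $C$ of $\Omega(X,J)$ that are dense in $\mathbf{Ck}(\{f\})$ and such that in $C$ there are infinitely many possibility sets of the cardinality of the continuum.
   Context: Formulas. $X$ (primitive propositions) and $J$ (agents) are finite sets. $\mathcal L=\mathcal L(X,J)$ is the smallest set of formulas containing $X$ and closed under $g\mapsto\neg g$, $(g,h)\mapsto g\wedge h$, and $g\mapsto k_jg$ for $j\in J$; $g\vee h$ and $g\to h$ are the usual abbreviations ($g\to h$ is $\neg g\vee h$). The multi-agent S5 logic has the rules modus ponens and necessitation (if $g$ is a theorem so is $k_jg$) and as axioms all substitution instances of propositional theorems, $(k_jg\wedge k_j(g\to h))\to k_jh$, $k_jg\to g$, $k_jg\to k_jk_jg$, $\neg k_jg\to k_j\neg k_jg$. A set of formulas is consistent if no finite subset leads to a contradiction in this logic, and complete if for each formula $g$ it contains $g$ or $\neg g$. $\Omega=\Omega(X,J)$ is the set of all complete and consistent subsets of $\mathcal L$. Partitions, cells, topology. For $j\in J$, $\mathcal Q^j$ is the partition of $\Omega$ in which $z,z'$ are equivalent iff $\{g: k_jg\in z\}=\{g:k_jg\in z'\}$. A possibility set is a member of some $\mathcal Q^j$. A cell is a member of the meet partition $\bigwedge_{j\in J}\mathcal Q^j$, i.e. a minimal non-empty $C\subseteq\Omega$ such that $P\in\mathcal Q^j$ and $P\cap C\neq\emptyset$ imply $P\subseteq C$, for all $j$. The topology of $\Omega$ has as base the sets $\{z\in\Omega: g\in z\}$,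 $g\in\mathcal L$. Let $E^0g=g$, $E g=\bigwedge_{j\in J}k_jg$, $E^{n}g=E(E^{n-1}g)$, and $\mathbf{Ck}(\{f\})=\{z\in\Omega: E^nf\in z\text{ for all }n\ge 0\}$. A cell $C$ is dense in $\mathbf{Ck}(\{f\})$ if $C\subseteq \mathbf{Ck}(\{f\})$ and $C$ is dense in it in the relative topology. Finite levels. Depth: $\mathrm{depth}(x)=0$ for $x\in X$, $\mathrm{depth}(\neg g)=\mathrm{depth}(g)$, $\mathrm{depth}(g\wedge h)=\max(\mathrm{depth}(g),\mathrm{depth}(h))$, $\mathrm{depth}(k_jg)=\mathrm{depth}(g)+1$. $\mathcal L_i$ is the set of formulas of depth $\le i$; $\Omega_i$ is the (finite) set of maximally consistent subsets of $\mathcal L_i$; $\pi_i:\Omega\to\Omega_i$, $\pi_i(z)=z\cap\mathcal L_i$ (surjective). $\mathcal G_i=\{\pi_i^{-1}(w):w\in\Omega_i\}$. For $i\ge1$, $\overline{\mathcal F}_i^j$ is the partition of $\Omega_i$ in which $w,w'$ are equivalent iff $\{g\in\mathcal L_{i-1}:k_jg\in w\}=\{g\in\mathcal L_{i-1}:k_jg\in w'\}$; $\overline{\mathcal F}_0^j=\{\Omega_0\}$; $\mathcal F_i^j=\{\pi_i^{-1}(B):B\in\overline{\mathcal F}_i^j\}$. For a formula $f$ of depth $d$, $\alpha^{\Omega_d}(f)=\{w\in\Omega_d:f\in w\}$. Generative formulas. For $i>0$ a non-empty $A\subseteq\Omega_i$ is semantically closed if for all $j\in J$, $B\in\mathcal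 G_{i-1}$, $w\in A$: if $\pi_i^{-1}(w)\subseteq F\in\mathcal F_i^j$ and $F\cap B\ne\emptyset$ then $F\cap B\cap\pi_i^{-1}(A)\neq\emptyset$. Every non-empty subset of $\Omega_0$ is semantically closed. A subset $A\subseteq\Omega_d$ is connected if any two of its elements are joined by a finite sequence in $A$ in which consecutive elements share a member of $\overline{\mathcal F}_d^j$ for some $j\in J$. A formula $f$ with $d=\mathrm{depth}(f)$ and $|J|\ge2$ is generative if $\alpha^{\Omega_d}(f)$ is semantically closed and connected, and there exists more than one cell dense in $\mathbf{Ck}(\{f\})$. *)

theory Defs
  imports "HOL-Analysis.Analysis"
begin

section \<open>Formulas and multi-agent S5\<close>

text \<open>
  The finite sets of primitive propositions and of agents are the types \<open>'x\<close> and \<open>'j\<close>.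
  Nothing is lost by types being non-empty: without primitive propositions there are no formulas,
  and generative formulas presuppose at least two agents.
\<close>

datatype ('x, 'j) fm =
    Atom 'x
  | Neg "('x, 'j) fm"
  | Conj "('x, 'j) fm" "('x, 'j) fm"
  | K 'j "('x, 'j) fm"

abbreviation Disj :: "('x, 'j) fm \<Rightarrow> ('x, 'j) fm \<Rightarrow> ('x, 'j) fm" where
  "Disj g h \<equiv> Neg (Conj (Neg g) (Neg h))"

abbreviation Imp :: "('x, 'j) fm \<Rightarrow> ('x, 'j) fm \<Rightarrow> ('x, 'j) fm" where
  "Imp g h \<equiv> Disj (Neg g) h"

datatype pfm = PVar nat | PNeg pfm | PConj pfm pfm

primrec peval :: "(nat \<Rightarrow> bool) \<Rightarrow> pfm \<Rightarrow> bool" where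
  "peval v (PVar n) = v n"
| "peval v (PNeg p) = (\<not> peval v p)"
| "peval v (PConj p q) = (peval v p \<and> peval v q)"

primrec psubst :: "(nat \<Rightarrow> ('x, 'j) fm) \<Rightarrow> pfm \<Rightarrow> ('x, 'j) fm" where
  "psubst s (PVar n) = s n"
| "psubst s (PNeg p) = Neg (psubst s p)"
| "psubst s (PConj p q) = Conj (psubst s p) (psubst s q)"

inductive S5 :: "('x, 'j) fm \<Rightarrow> bool" where
  taut: "(\<And>v. peval v p) \<Longrightarrow> S5 (psubst s p)"
| axK: "S5 (Imp (Conj (K j g) (K j (Imp g h))) (K j h))"
| axT: "S5 (Imp (K j g) g)"
| ax4: "S5 (Imp (K j g) (K j (K j g)))"
| ax5: "S5 (Imp (Neg (K j g)) (K j (Neg (K j g))))"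
| mp: "S5 g \<Longrightarrow> S5 (Imp g h) \<Longrightarrow> S5 h"
| nec: "S5 g \<Longrightarrow> S5 (K j g)"

text \<open>
  A finite set of formulas, listed as \<open>gs = [g\<^sub>1, \<dots>, g\<^sub>n]\<close>, leads to \<open>c\<close> when
  \<open>g\<^sub>1 \<rightarrow> \<dots> \<rightarrow> g\<^sub>n \<rightarrow> c\<close> is a theorem; so necessitation is applied to theorems only.
\<close>

definition consistent :: "('x, 'j) fm set \<Rightarrow> bool" where
  "consistent S \<longleftrightarrow>
     \<not> (\<exists>gs h. set gs \<subseteq> S \<and> S5 (foldr Imp gs (Conj h (Neg h))))"

definition complete_fms :: "('x, 'j) fm set \<Rightarrow> bool" where
  "complete_fms S \<longleftrightarrow> (\<forall>g. g \<in> S \<or> Neg g \<in> S)"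

definition Omega :: "('x, 'j) fm set set" where
  "Omega = {z. complete_fms z \<and> consistent z}"


section \<open>Possibility sets, cells, topology\<close>

definition Q :: "'j \<Rightarrow> ('x, 'j) fm set set set" where
  "Q j = Omega // {(z, z'). z \<in> Omega \<and> z' \<in> Omega \<and> {g. K j g \<in> z} = {g. K j g \<in> z'}}"

definition possibility_set :: "('x, 'j) fm set set \<Rightarrow> bool" where
  "possibility_set P \<longleftrightarrow> (\<exists>j. P \<in> Q j)"

definition Q_closed :: "('x, 'j) fm set set \<Rightarrow> bool" where
  "Q_closed C \<longleftrightarrow> (\<forall>j. \<forall>P\<in>Q j. P \<inter> C \<noteq> {} \<longrightarrow> P \<subseteq> C)"

definition cell :: "('x, 'j) fm set set \<Rightarrow> bool" where
  "cell C \<longleftrightarrow> C \<noteq> {} \<and> C \<subseteq> Omega \<and> Q_closed C \<and>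
     (\<forall>D. D \<noteq> {} \<and> D \<subseteq> C \<and> Q_closed D \<longrightarrow> D = C)"

definition Omega_top :: "('x, 'j) fm set topology" where
  "Omega_top = topology_generated_by (range (\<lambda>g. {z \<in> Omega. g \<in> z}))"

text \<open>The generating sets form a base of this topology, not only a subbase.\<close>

lemma Omega_Conj_iff:
  assumes z: "z \<in> Omega"
  shows "Conj g h \<in> z \<longleftrightarrow> g \<in> z \<and> h \<in> z"
proof -
  have cmp: "f \<in> z \<or> Neg f \<in> z" for f
    using z by (simp add: Omega_def complete_fms_def)
  have con: False if "set gs \<subseteq> z" "S5 (foldr Imp gs (Conj c (Neg c)))" for gs c
    using z that unfolding Omega_def consistent_def by blast
  let ?imp = "\<lambda>p q. PNeg (PConj (PNeg (PNeg p)) (PNeg q))"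
  let ?s = "\<lambda>n::nat. if n = 0 then g else h"
  let ?bot = "PConj (PVar 0) (PNeg (PVar 0))"
  have 1: "S5 (foldr Imp [Conj g h, Neg g] (Conj g (Neg g)))"
    using taut[of "?imp (PConj (PVar 0) (PVar 1)) (?imp (PNeg (PVar 0)) ?bot)" ?s] by simp
  have 2: "S5 (foldr Imp [Conj g h, Neg h] (Conj g (Neg g)))"
    using taut[of "?imp (PConj (PVar 0) (PVar 1)) (?imp (PNeg (PVar 1)) ?bot)" ?s] by simp
  have 3: "S5 (foldr Imp [g, h, Neg (Conj g h)] (Conj g (Neg g)))"
    using taut[of "?imp (PVar 0) (?imp (PVar 1)
      (?imp (PNeg (PConj (PVar 0) (PVar 1))) ?bot))" ?s] by simp
  show ?thesis
    using con[OF _ 1] con[OF _ 2] con[OF _ 3] cmp[of g] cmp[of h] cmp[of "Conj g h"] by auto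
qed

lemma openin_Omega_top:
  "openin (Omega_top :: ('x, 'j) fm set topology) =
     arbitrary union_of (\<lambda>U. U \<in> range (\<lambda>g. {z \<in> Omega. g \<in> z}))"
  (is "_ = arbitrary union_of ?P")
proof -
  have "{z \<in> Omega. g \<in> z} \<inter> {z \<in> Omega. h \<in> z} = {z \<in> Omega. Conj g h \<in> z}"
    for g h :: "('x, 'j) fm"
    by (auto simp: Omega_Conj_iff)
  then have int: "?P (U \<inter> V)" if "?P U" "?P V" for U V
    using that by auto
  have top: "istopology (arbitrary union_of ?P)"
    by (rule istopology_base) (use int in blast)
  show ?thesis
  proof (intro ext iffI)
    fix U :: "('x, 'j) fm set set" assume "openin Omega_top U"
    then have gen: "generate_topology_on (range (\<lambda>g. {z \<in> Omega. g \<in> z})) U"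
      by (simp only: Omega_top_def openin_topology_generated_by_iff)
    show "(arbitrary union_of ?P) U"
      by (rule generate_topology_on_coarsest[OF top _ gen]) (rule arbitrary_union_of_inc)
  next
    fix U :: "('x, 'j) fm set set" assume "(arbitrary union_of ?P) U"
    then obtain \<U> where \<U>: "\<U> \<subseteq> Collect ?P" "\<Union>\<U> = U"
      unfolding union_of_def by blast
    have "openin Omega_top V" if "V \<in> \<U>" for V
      unfolding Omega_top_def
      by (rule topology_generated_by_Basis) (use \<U>(1) that in blast)
    then show "openin Omega_top U"
      unfolding \<U>(2)[symmetric] by (rule openin_Union)
  qed
qed


section \<open>Common knowledge\<close>

definition agents :: "'j::finite list" where
  "agents = (SOME js. distinct js \<and> set js = UNIV)"

lemma agents: "distinct (agents :: 'j::finite list)" "set (agents :: 'j list) = UNIV"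
proof -
  have "\<exists>js::'j list. distinct js \<and> set js = UNIV"
    using finite_distinct_list[of "UNIV :: 'j set"] by auto
  then have "distinct (agents :: 'j list) \<and> set (agents :: 'j list) = UNIV"
    unfolding agents_def by (rule someI_ex)
  then show "distinct (agents :: 'j list)" "set (agents :: 'j list) = UNIV" by auto
qed

primrec big_conj :: "('x, 'j) fm \<Rightarrow> ('x, 'j) fm list \<Rightarrow> ('x, 'j) fm" where
  "big_conj g [] = g"
| "big_conj g (h # hs) = Conj g (big_conj h hs)"

definition E :: "('x, 'j::finite) fm \<Rightarrow> ('x, 'j) fm" where
  "E g = big_conj (K (hd agents) g) (map (\<lambda>j. K j g) (tl agents))"

definition Ck :: "('x, 'j::finite) fm \<Rightarrow> ('x, 'j) fm set set" where
  "Ck f = {z \<in> Omega. \<forall>n. (E ^^ n) f \<in> z}"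

definition dense_in_Ck :: "('x, 'j::finite) fm set set \<Rightarrow> ('x, 'j) fm \<Rightarrow> bool" where
  "dense_in_Ck C f \<longleftrightarrow> C \<subseteq> Ck f \<and> subtopology Omega_top (Ck f) closure_of C = Ck f"


section \<open>Finite levels\<close>

primrec depth :: "('x, 'j) fm \<Rightarrow> nat" where
  "depth (Atom x) = 0"
| "depth (Neg g) = depth g"
| "depth (Conj g h) = max (depth g) (depth h)"
| "depth (K j g) = Suc (depth g)"

definition L :: "nat \<Rightarrow> ('x, 'j) fm set" where
  "L i = {g. depth g \<le> i}"

definition Omega_lev :: "nat \<Rightarrow> ('x, 'j) fm set set" where
  "Omega_lev i = {w. w \<subseteq> L i \<and> consistent w \<and> (\<forall>w'. w \<subset> w' \<and> w' \<subseteq> L i \<longrightarrow> \<not> consistent w')}"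

definition proj :: "nat \<Rightarrow> ('x, 'j) fm set \<Rightarrow> ('x, 'j) fm set" where
  "proj i z = z \<inter> L i"

definition proj_inv :: "nat \<Rightarrow> ('x, 'j) fm set set \<Rightarrow> ('x, 'j) fm set set" where
  "proj_inv i B = {z \<in> Omega. proj i z \<in> B}"

definition G :: "nat \<Rightarrow> ('x, 'j) fm set set set" where
  "G i = (\<lambda>w. proj_inv i {w}) ` Omega_lev i"

definition Fbar :: "nat \<Rightarrow> 'j \<Rightarrow> ('x, 'j) fm set set set" where
  "Fbar i j = (if i = 0 then {Omega_lev 0} else
     Omega_lev i // {(w, w'). w \<in> Omega_lev i \<and> w' \<in> Omega_lev i \<and>
       {g \<in> L (i - 1). K j g \<in> w} = {g \<in> L (i - 1). K j g \<in> w'}})"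

definition F :: "nat \<Rightarrow> 'j \<Rightarrow> ('x, 'j) fm set set set" where
  "F i j = proj_inv i ` Fbar i j"

definition alpha :: "nat \<Rightarrow> ('x, 'j) fm \<Rightarrow> ('x, 'j) fm set set" where
  "alpha d f = {w \<in> Omega_lev d. f \<in> w}"


section \<open>Generative formulas\<close>

definition semantically_closed :: "nat \<Rightarrow> ('x, 'j) fm set set \<Rightarrow> bool" where
  "semantically_closed i A \<longleftrightarrow> A \<noteq> {} \<and> A \<subseteq> Omega_lev i \<and>
     (i > 0 \<longrightarrow> (\<forall>j. \<forall>B \<in> G (i - 1). \<forall>w \<in> A. \<forall>D \<in> F i j.
        proj_inv i {w} \<subseteq> D \<and> D \<inter> B \<noteq> {} \<longrightarrow> D \<inter> B \<inter> proj_inv i A \<noteq> {}))"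

definition connected_lev :: "nat \<Rightarrow> ('x, 'j) fm set set \<Rightarrow> bool" where
  "connected_lev d A \<longleftrightarrow> (\<forall>w \<in> A. \<forall>w' \<in> A.
     (w, w') \<in> {(u, v). u \<in> A \<and> v \<in> A \<and> (\<exists>j. \<exists>B \<in> Fbar d j. u \<in> B \<and> v \<in> B)}\<^sup>*)"

definition generative :: "('x, 'j::finite) fm \<Rightarrow> bool" where
  "generative f \<longleftrightarrow> CARD('j) \<ge> 2 \<and>
     semantically_closed (depth f) (alpha (depth f) f) \<and>
     connected_lev (depth f) (alpha (depth f) f) \<and>
     (\<exists>C C'. C \<noteq> C' \<and> cell C \<and> dense_in_Ck C f \<and> cell C' \<and> dense_in_Ck C' f)"

end

theory Submission
  imports Defs
begin

text \<open>
  The proof is a Baire category argument on the compact space \<open>X = Ck f\<close>, whose basic open sets are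
  given by formulas. Two distinct dense cells meet every basic open set, so for each word \<open>w\<close> of agents the
  closed relation "reachable along \<open>w\<close>" has dense complement in \<open>X \<times> X\<close>; as in Mycielski's theorem, a
  Cantor scheme produces continuum many points in pairwise distinct cells, all of them in a prescribed countable
  intersection of dense open sets. Having a dense cell is such a condition, and so is having only perfect
  possibility sets, together with its iterates saying that points of this kind are dense in every possibility set.
  A cell with only finitely many uncountable possibility sets would then contain the dense closed union
  of these sets, hence would be all of \<open>X\<close>, contradicting the existence of two cells.

  What remains is that possibility sets are perfect at a dense set of points. As \<open>f\<close> has finite depth, it stays
  true everywhere if the canonical model is modified in a way that preserves the truth of finitely many formulas
  only; uniting the possibility sets of two points that agree on these formulas is such a modification.
\<close>

section \<open>Propositional reasoning and maximal consistent sets\<close>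

text \<open>Two dense cells put two different points into every basic open set, but these points lie
  in different cells, whereas a perfect possibility set needs them side by side. Uniting possibility
  sets brings them together. The obstacle is that this may level the very difference between the
  points, namely if it concerns the knowledge of the agent in question; a second agent then has to
  carry the difference.

  They are available in a single possibility set. Generic points are therefore propagated from one
  possibility set to the next along a word of agents, and this is why the conditions have to be
  iterated.

  Everything topological is expressed by formulas: iterated \<open>K\<close> along a word describes
  reachability, and its dual describes an open condition. As formulas and words are countable,
  countably many conditions suffice, and they can be met all at once.\<close>

instance fm :: (countable, countable) countable
  by countable_datatype

primrec peval_fm :: "(('x, 'j) fm \<Rightarrow> bool) \<Rightarrow> ('x, 'j) fm \<Rightarrow> bool" where
  "peval_fm v (Atom x) = v (Atom x)"
| "peval_fm v (Neg g) = (\<not> peval_fm v g)"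
| "peval_fm v (Conj g h) = (peval_fm v g \<and> peval_fm v h)"
| "peval_fm v (K j g) = v (K j g)"

primrec to_pfm :: "('x::countable, 'j::countable) fm \<Rightarrow> pfm" where
  "to_pfm (Atom x) = PVar (to_nat (Atom x :: ('x, 'j) fm))"
| "to_pfm (Neg g) = PNeg (to_pfm g)"
| "to_pfm (Conj g h) = PConj (to_pfm g) (to_pfm h)"
| "to_pfm (K j g) = PVar (to_nat (K j g))"

lemma psubst_to_pfm: "psubst from_nat (to_pfm g) = g"
  by (induction g) auto

lemma peval_to_pfm: "peval v (to_pfm g) = peval_fm (v \<circ> to_nat) g"
  by (induction g) auto

text \<open>The formula is the instance under \<open>from_nat\<close> of its own skeleton
  \<open>to_pfm g\<close>, in which formulas headed by \<open>Atom\<close> or \<open>K\<close> count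
  as variables. Propositional derivations thus reduce to checking valuations.\<close>

lemma S5_tautology:
  fixes g :: "('x::countable, 'j::countable) fm"
  assumes "\<And>v. peval_fm v g"
  shows "S5 g"
proof -
  have "S5 (psubst from_nat (to_pfm g) :: ('x, 'j) fm)"
    by (rule taut) (simp add: peval_to_pfm assms)
  then show ?thesis by (simp add: psubst_to_pfm)
qed

lemma S5_propositional1:
  fixes g h :: "('x::countable, 'j::countable) fm"
  assumes "S5 g" "\<And>v. peval_fm v g \<Longrightarrow> peval_fm v h"
  shows "S5 h"
proof -
  have "S5 (Imp g h)" by (rule S5_tautology) (use assms(2) in auto)
  then show ?thesis using assms(1) mp by blast
qed

lemma S5_propositional2:
  fixes g g' h :: "('x::countable, 'j::countable) fm"
  assumes "S5 g" "S5 g'" "\<And>v. peval_fm v g \<Longrightarrow> peval_fm v g' \<Longrightarrow> peval_fm v h"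
  shows "S5 h"
proof -
  have "S5 (Imp g (Imp g' h))" by (rule S5_tautology) (use assms(3) in auto)
  then show ?thesis using assms(1,2) mp by blast
qed

lemma peval_fm_foldr_Imp:
  "peval_fm v (foldr Imp gs c) \<longleftrightarrow> ((\<forall>g\<in>set gs. peval_fm v g) \<longrightarrow> peval_fm v c)"
  by (induction gs) auto

text \<open>If both extensions are refuted, the premises taken from \<open>S\<close> already form a
  refutation: under any valuation, the refutation using the true one of \<open>g\<close> and
  \<open>Neg g\<close> has a false premise, which must lie in \<open>S\<close>.\<close>

lemma consistent_insert:
  fixes S :: "('x::countable, 'j::countable) fm set"
  assumes "consistent S"
  shows "consistent (insert g S) \<or> consistent (insert (Neg g) S)"
proof (rule ccontr)
  assume "\<not> ?thesis"
  then obtain gs hs c d where gs: "set gs \<subseteq> insert g S" "S5 (foldr Imp gs (Conj c (Neg c)))"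
    and hs: "set hs \<subseteq> insert (Neg g) S" "S5 (foldr Imp hs (Conj d (Neg d)))"
    unfolding consistent_def by blast
  let ?l = "filter (\<lambda>h. h \<in> S) (gs @ hs)"
  have "S5 (foldr Imp ?l (Conj c (Neg c)))"
  proof (rule S5_propositional2[OF gs(2) hs(2)])
    fix v
    assume 1: "peval_fm v (foldr Imp gs (Conj c (Neg c)))"
      "peval_fm v (foldr Imp hs (Conj d (Neg d)))"
    show "peval_fm v (foldr Imp ?l (Conj c (Neg c)))"
    proof (cases "peval_fm v g")
      case True
      obtain h where "h \<in> set gs" "\<not> peval_fm v h" using 1(1) by (auto simp: peval_fm_foldr_Imp)
      then have "h \<in> set ?l" "\<not> peval_fm v h" using gs(1) True by auto
      then show ?thesis unfolding peval_fm_foldr_Imp by blast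
    next
      case False
      obtain h where "h \<in> set hs" "\<not> peval_fm v h" using 1(2) by (auto simp: peval_fm_foldr_Imp)
      then have "h \<in> set ?l" "\<not> peval_fm v h" using hs(1) False by auto
      then show ?thesis unfolding peval_fm_foldr_Imp by blast
    qed
  qed
  moreover have "set ?l \<subseteq> S" by auto
  ultimately show False using assms unfolding consistent_def by blast
qed

lemma Lindenbaum:
  fixes S :: "('x::countable, 'j::countable) fm set"
  assumes "consistent S"
  obtains z where "z \<in> Omega" "S \<subseteq> z"
proof -
  let ?A = "{T. S \<subseteq> T \<and> consistent T}"
  have "\<exists>M\<in>?A. \<forall>Y\<in>?A. M \<subseteq> Y \<longrightarrow> Y = M"
  proof (rule subset_Zorn_nonempty)
    show "?A \<noteq> {}" using assms by auto
  next
    fix \<C> assume C: "\<C> \<noteq> {}" "subset.chain ?A \<C>"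
    have CA: "\<C> \<subseteq> ?A" using C(2) by (simp add: subset.chain_def)
    have "consistent (\<Union>\<C>)"
      unfolding consistent_def
    proof
      assume "\<exists>gs h. set gs \<subseteq> \<Union>\<C> \<and> S5 (foldr Imp gs (Conj h (Neg h)))"
      then obtain gs h where gs: "set gs \<subseteq> \<Union>\<C>" "S5 (foldr Imp gs (Conj h (Neg h)))" by blast
      obtain T where "T \<in> \<C>" "set gs \<subseteq> T"
        using finite_subset_Union_chain[OF _ gs(1) C] by auto
      then show False using CA gs(2) unfolding consistent_def by blast
    qed
    then show "\<Union>\<C> \<in> ?A" using C(1) CA by auto
  qed
  then obtain M where M: "S \<subseteq> M" "consistent M"
    and max: "\<And>Y. consistent Y \<Longrightarrow> M \<subseteq> Y \<Longrightarrow> Y = M"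
    using order_trans by (smt (verit, best) mem_Collect_eq)
  have "complete_fms M"
    unfolding complete_fms_def
  proof
    fix g
    show "g \<in> M \<or> Neg g \<in> M"
      using consistent_insert[OF M(2), of g] max[of "insert g M"] max[of "insert (Neg g) M"] by blast
  qed
  then show thesis using that M by (auto simp: Omega_def)
qed

section \<open>Points of \<open>Omega\<close> respect the connectives and the axioms;
  compactness\<close>

lemma Omega_no_contradiction:
  assumes "z \<in> Omega" "set gs \<subseteq> z"
  shows "\<not> S5 (foldr Imp gs (Conj h (Neg h)))"
  using assms unfolding Omega_def consistent_def by blast

lemma Omega_Neg_iff:
  fixes g :: "('x::countable, 'j::countable) fm"
  assumes "z \<in> Omega"
  shows "Neg g \<in> z \<longleftrightarrow> g \<notin> z"
proof -
  have "S5 (foldr Imp [g, Neg g] (Conj g (Neg g)))" by (rule S5_tautology) auto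
  then have "\<not> (g \<in> z \<and> Neg g \<in> z)"
    using Omega_no_contradiction[OF assms, of "[g, Neg g]"] by auto
  moreover have "g \<in> z \<or> Neg g \<in> z" using assms by (auto simp: Omega_def complete_fms_def)
  ultimately show ?thesis by blast
qed

lemma Omega_S5:
  fixes g :: "('x::countable, 'j::countable) fm"
  assumes "z \<in> Omega" "S5 g"
  shows "g \<in> z"
proof (rule ccontr)
  assume "g \<notin> z"
  then have "Neg g \<in> z" using assms Omega_Neg_iff by blast
  moreover have "S5 (foldr Imp [Neg g] (Conj g (Neg g)))"
    by (rule S5_propositional1[OF assms(2)]) auto
  ultimately show False using Omega_no_contradiction[OF assms(1), of "[Neg g]"] by auto
qed

lemmas Omega_simps = Omega_Neg_iff Omega_Conj_iff

lemma Omega_T: "z \<in> Omega \<Longrightarrow> K j g \<in> z \<Longrightarrow> g \<in> z" for g :: "('x::countable, 'j::countable) fm"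
  using Omega_S5[OF _ axT[of j g]] by (auto simp: Omega_simps)

lemma Omega_4: "z \<in> Omega \<Longrightarrow> K j g \<in> z \<Longrightarrow> K j (K j g) \<in> z"
  for g :: "('x::countable, 'j::countable) fm"
  using Omega_S5[OF _ ax4[of j g]] by (auto simp: Omega_simps)

lemma Omega_5: "z \<in> Omega \<Longrightarrow> K j g \<notin> z \<Longrightarrow> K j (Neg (K j g)) \<in> z"
  for g :: "('x::countable, 'j::countable) fm"
  using Omega_S5[OF _ ax5[of j g]] by (auto simp: Omega_simps)

lemma Omega_K: "z \<in> Omega \<Longrightarrow> K j g \<in> z \<Longrightarrow> K j (Imp g h) \<in> z \<Longrightarrow> K j h \<in> z"
  for g :: "('x::countable, 'j::countable) fm"
  using Omega_S5[OF _ axK[of j g h]] by (auto simp: Omega_simps)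

lemma Omega_K_foldr:
  fixes g :: "('x::countable, 'j::countable) fm"
  assumes z: "z \<in> Omega" and "\<forall>h\<in>set gs. K j h \<in> z" "K j (foldr Imp gs g) \<in> z"
  shows "K j g \<in> z"
  using assms(2,3)
proof (induction gs)
  case (Cons a gs)
  then show ?case using Omega_K[OF z, of j a "foldr Imp gs g"] by auto
qed simp

lemma Omega_compact:
  fixes T :: "('x::countable, 'j::countable) fm set"
  assumes "\<And>S. finite S \<Longrightarrow> S \<subseteq> T \<Longrightarrow> \<exists>z\<in>Omega. S \<subseteq> z"
  obtains z where "z \<in> Omega" "T \<subseteq> z"
proof -
  have "consistent T"
    unfolding consistent_def using assms Omega_no_contradiction by (metis finite_set)
  then show thesis using Lindenbaum that by blast
qed


section \<open>Possibility sets in the canonical model\<close>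

definition sim :: "'j \<Rightarrow> ('x, 'j) fm set \<Rightarrow> ('x, 'j) fm set \<Rightarrow> bool" where
  "sim j z z' \<longleftrightarrow> z \<in> Omega \<and> z' \<in> Omega \<and> {g. K j g \<in> z} = {g. K j g \<in> z'}"

lemma sim_refl: "z \<in> Omega \<Longrightarrow> sim j z z"
  and sim_sym: "sim j z z' \<Longrightarrow> sim j z' z"
  and sim_trans: "sim j z z' \<Longrightarrow> sim j z' z'' \<Longrightarrow> sim j z z''"
  by (auto simp: sim_def)

lemma sim_Omega: "sim j z z' \<Longrightarrow> z \<in> Omega" "sim j z z' \<Longrightarrow> z' \<in> Omega"
  by (auto simp: sim_def)

lemma sim_K_iff: "sim j z z' \<Longrightarrow> K j g \<in> z \<longleftrightarrow> K j g \<in> z'"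
  by (auto simp: sim_def)

lemma sim_K_D:
  fixes g :: "('x::countable, 'j::countable) fm"
  shows "sim j z z' \<Longrightarrow> K j g \<in> z \<Longrightarrow> g \<in> z'"
  using Omega_T[of z' j g] by (simp add: sim_def set_eq_iff)

lemma K_mem_iff:
  fixes g :: "('x::countable, 'j::countable) fm"
  assumes z: "z \<in> Omega"
  shows "K j g \<in> z \<longleftrightarrow> (\<forall>z'. sim j z z' \<longrightarrow> g \<in> z')"
proof
  assume "\<forall>z'. sim j z z' \<longrightarrow> g \<in> z'"
  show "K j g \<in> z"
  proof (rule ccontr)
    assume not: "K j g \<notin> z"
    let ?T = "insert (Neg g) {h. K j h \<in> z}"
    have "consistent ?T"
      unfolding consistent_def
    proof
      assume "\<exists>gs h. set gs \<subseteq> ?T \<and> S5 (foldr Imp gs (Conj h (Neg h)))"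
      then obtain gs h where gs: "set gs \<subseteq> ?T" "S5 (foldr Imp gs (Conj h (Neg h)))" by blast
      let ?l = "filter (\<lambda>h. K j h \<in> z) gs"
      have "S5 (foldr Imp ?l g)"
      proof (rule S5_propositional1[OF gs(2)])
        fix v assume "peval_fm v (foldr Imp gs (Conj h (Neg h)))"
        then obtain a where "a \<in> set gs" "\<not> peval_fm v a" by (auto simp: peval_fm_foldr_Imp)
        then have "peval_fm v g \<or> a \<in> set ?l \<and> \<not> peval_fm v a" using gs(1) by auto
        then show "peval_fm v (foldr Imp ?l g)" unfolding peval_fm_foldr_Imp by blast
      qed
      then have "K j (foldr Imp ?l g) \<in> z" by (intro Omega_S5[OF z] nec)
      then have "K j g \<in> z" by (rule Omega_K_foldr[OF z, rotated]) simp
      then show False using not by blast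
    qed
    then obtain z' where z': "z' \<in> Omega" "?T \<subseteq> z'" using Lindenbaum by blast
    \<comment> \<open>By the axioms 4 and 5, \<open>z\<close> knows either \<open>K j h\<close> or
      its negation, so \<open>?T\<close> decides all knowledge of \<open>j\<close> in the way
      \<open>z\<close> does. Inclusion of knowledge thereby becomes equality.\<close>
    have "K j h \<in> z \<longleftrightarrow> K j h \<in> z'" for h
      using z'(2) Omega_4[OF z, of j h] Omega_5[OF z, of j h] Omega_Neg_iff[OF z'(1), of "K j h"]
      by blast
    then have "sim j z z'" using z z'(1) by (auto simp: sim_def)
    then have "g \<in> z'" using \<open>\<forall>z'. sim j z z' \<longrightarrow> g \<in> z'\<close> by blast
    then show False using z' Omega_Neg_iff by auto
  qed
qed (use sim_K_D in blast)

abbreviation M :: "'j \<Rightarrow> ('x, 'j) fm \<Rightarrow> ('x, 'j) fm" where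
  "M j g \<equiv> Neg (K j (Neg g))"

lemma M_mem_iff:
  fixes g :: "('x::countable, 'j::countable) fm"
  assumes z: "z \<in> Omega"
  shows "M j g \<in> z \<longleftrightarrow> (\<exists>z'. sim j z z' \<and> g \<in> z')"
proof -
  have "M j g \<in> z \<longleftrightarrow> \<not> (\<forall>z'. sim j z z' \<longrightarrow> Neg g \<in> z')"
    unfolding Omega_Neg_iff[OF z] K_mem_iff[OF z] ..
  also have "\<dots> \<longleftrightarrow> (\<exists>z'. sim j z z' \<and> Neg g \<notin> z')" by blast
  also have "\<dots> \<longleftrightarrow> (\<exists>z'. sim j z z' \<and> g \<in> z')"
    using Omega_Neg_iff[OF sim_Omega(2), of j z] by auto
  finally show ?thesis .
qed

lemma sim_compact:
  fixes T :: "('x::countable, 'j::countable) fm set"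
  assumes fin: "\<And>S. finite S \<Longrightarrow> S \<subseteq> T \<Longrightarrow> \<exists>z'. sim j z z' \<and> S \<subseteq> z'" and z: "z \<in> Omega"
  obtains z' where "sim j z z'" "T \<subseteq> z'"
proof -
  \<comment> \<open>\<open>?U\<close> axiomatises the possibility set of \<open>z\<close>, which is
    thus closed in the compact space \<open>Omega\<close>.\<close>
  let ?U = "{K j g |g. K j g \<in> z} \<union> {Neg (K j g) |g. K j g \<notin> z}"
  have U: "?U \<subseteq> z'" if "sim j z z'" for z'
    using that Omega_Neg_iff[of z'] sim_K_iff[OF that] by (auto simp: sim_Omega)
  have fin': "\<exists>z'\<in>Omega. S \<subseteq> z'" if S: "finite S" "S \<subseteq> T \<union> ?U" for S
  proof -
    obtain z' where "sim j z z'" "S \<inter> T \<subseteq> z'" using fin[of "S \<inter> T"] S(1) by auto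
    then have "S \<subseteq> z'" using U[of z'] S(2) by blast
    then show ?thesis using sim_Omega(2)[OF \<open>sim j z z'\<close>] by blast
  qed
  obtain z' where z': "z' \<in> Omega" "T \<union> ?U \<subseteq> z'" by (rule Omega_compact[OF fin'])
  have "K j g \<in> z \<longleftrightarrow> K j g \<in> z'" for g
    using z'(2) Omega_Neg_iff[OF z'(1), of "K j g"] by (cases "K j g \<in> z") auto
  then have "sim j z z'" using z z'(1) by (auto simp: sim_def)
  then show thesis using that z'(2) by blast
qed

lemma Q_eq: "Q j = {{z'. sim j z z'} |z. z \<in> Omega}"
  by (auto simp: Q_def quotient_def sim_def)


section \<open>Kripke models and surgery on the canonical model\<close>

primrec sat :: "('w \<Rightarrow> 'x \<Rightarrow> bool) \<Rightarrow> ('j \<Rightarrow> ('w \<times> 'w) set) \<Rightarrow> 'w \<Rightarrow> ('x, 'j) fm \<Rightarrow> bool" where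
  "sat V R w (Atom x) = V w x"
| "sat V R w (Neg g) = (\<not> sat V R w g)"
| "sat V R w (Conj g h) = (sat V R w g \<and> sat V R w h)"
| "sat V R w (K j g) = (\<forall>v. (w, v) \<in> R j \<longrightarrow> sat V R v g)"

definition fm_theory :: "('w \<Rightarrow> 'x \<Rightarrow> bool) \<Rightarrow> ('j \<Rightarrow> ('w \<times> 'w) set) \<Rightarrow> 'w \<Rightarrow> ('x, 'j) fm set" where
  "fm_theory V R w = {g. sat V R w g}"

lemma mem_fm_theory [simp]: "g \<in> fm_theory V R w \<longleftrightarrow> sat V R w g"
  by (simp add: fm_theory_def)

lemma sat_psubst: "sat V R w (psubst s p) \<longleftrightarrow> peval (\<lambda>n. sat V R w (s n)) p"
  by (induction p) auto

lemma S5_sound: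
  assumes "S5 g" "\<And>j. equiv W (R j)" "w \<in> W"
  shows "sat V R w g"
  using assms(1,3)
proof (induction arbitrary: w rule: S5.induct)
  case (axT j g)
  then show ?case using equiv_class_self[OF assms(2)] by auto
next
  case (ax4 j g)
  then show ?case using assms(2)[of j] by (auto simp: equiv_def dest: transD)
next
  case (ax5 j g)
  then show ?case using assms(2)[of j] by (auto simp: equiv_def dest: transD symD)
next
  case (nec g j)
  then show ?case using assms(2)[of j] equiv_type by auto
qed (auto simp: sat_psubst)

lemma sat_foldr_Imp: "sat V R w (foldr Imp gs c) \<longleftrightarrow> ((\<forall>g\<in>set gs. sat V R w g) \<longrightarrow> sat V R w c)"
  by (induction gs) auto

lemma fm_theory_Omega:
  assumes "\<And>j. equiv W (R j)" "w \<in> W"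
  shows "fm_theory V R w \<in> Omega"
proof -
  have "consistent (fm_theory V R w)"
    unfolding consistent_def
  proof
    assume "\<exists>gs h. set gs \<subseteq> fm_theory V R w \<and> S5 (foldr Imp gs (Conj h (Neg h)))"
    then obtain gs h where gs: "set gs \<subseteq> fm_theory V R w" "S5 (foldr Imp gs (Conj h (Neg h)))"
      by blast
    have "sat V R w (foldr Imp gs (Conj h (Neg h)))" using S5_sound[OF gs(2) assms] .
    then show False using gs(1) unfolding sat_foldr_Imp by auto
  qed
  then show ?thesis by (auto simp: Omega_def complete_fms_def)
qed

lemma fm_theory_sim:
  assumes "\<And>j. equiv W (R j)" "(w, v) \<in> R j"
  shows "sim j (fm_theory V R w) (fm_theory V R v)"
proof -
  have W: "w \<in> W" "v \<in> W" using assms(2) equiv_type[OF assms(1)[of j]] by auto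
  have "(w, u) \<in> R j \<longleftrightarrow> (v, u) \<in> R j" for u
    using assms(1)[of j] assms(2) unfolding equiv_def by (meson symD transD)
  then show ?thesis by (simp add: sim_def fm_theory_Omega[where R = R, OF assms(1)] W)
qed

definition fm_closed :: "('x, 'j) fm set \<Rightarrow> bool" where
  "fm_closed S \<longleftrightarrow> (\<forall>g. Neg g \<in> S \<longrightarrow> g \<in> S) \<and> (\<forall>g h. Conj g h \<in> S \<longrightarrow> g \<in> S \<and> h \<in> S) \<and>
     (\<forall>j g. K j g \<in> S \<longrightarrow> g \<in> S)"

lemma fm_closedD:
  assumes "fm_closed S"
  shows "Neg g \<in> S \<Longrightarrow> g \<in> S" "Conj g h \<in> S \<Longrightarrow> g \<in> S" "Conj g h \<in> S \<Longrightarrow> h \<in> S" "K j g \<in> S \<Longrightarrow> g \<in> S"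
  using assms unfolding fm_closed_def by blast+

text \<open>A truth lemma relative to a subformula-closed set: worlds carry points of
  \<open>Omega\<close> as labels, and the relations must fit the labels only at the
  \<open>K\<close>-formulas of \<open>S\<close>. The freedom left elsewhere is what surgery
  exploits.\<close>

lemma sat_iff_label:
  fixes S :: "('x::countable, 'j::countable) fm set"
  assumes W: "\<And>j. equiv W (R j)" and p: "\<And>w. w \<in> W \<Longrightarrow> p w \<in> Omega"
    and V: "V = (\<lambda>w x. Atom x \<in> p w)" and cl: "fm_closed S"
    and K: "\<And>w j g. w \<in> W \<Longrightarrow> K j g \<in> S \<Longrightarrow> K j g \<in> p w \<longleftrightarrow> (\<forall>v. (w, v) \<in> R j \<longrightarrow> g \<in> p v)"
    and "g \<in> S" "w \<in> W"
  shows "sat V R w g \<longleftrightarrow> g \<in> p w"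
  using assms(6,7)
proof (induction g arbitrary: w)
  case (Neg g)
  have "g \<in> S" using fm_closedD(1)[OF cl Neg.prems(1)] .
  then show ?case using Neg.IH Neg.prems(2) by (simp add: Omega_Neg_iff[OF p])
next
  case (Conj g h)
  have "g \<in> S" "h \<in> S" using fm_closedD(2,3)[OF cl Conj.prems(1)] by simp_all
  then show ?case using Conj.IH Conj.prems(2) by (simp add: Omega_Conj_iff[OF p])
next
  case (K j g)
  have "g \<in> S" using fm_closedD(4)[OF cl K.prems(1)] .
  moreover have "v \<in> W" if "(w, v) \<in> R j" for v using that equiv_type[OF W[of j]] by auto
  ultimately show ?case using assms(5)[OF K.prems(2,1)] K.IH by auto
qed (simp add: V)

text \<open>Relations of modified models are always given as kernels of a labelling, so surgery
  means changing labels and equivalence comes for free.\<close>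

lemma equiv_label: "equiv W {(u, v). u \<in> W \<and> v \<in> W \<and> l u = l v}"
  by (auto simp: equiv_def refl_on_def sym_def trans_def)

section \<open>Common knowledge of \<open>f\<close>, and surgery inside \<open>Ck f\<close>\<close>

lemma big_conj_mem:
  "z \<in> Omega \<Longrightarrow> big_conj g hs \<in> z \<longleftrightarrow> g \<in> z \<and> set hs \<subseteq> z"
  by (induction hs arbitrary: g) (auto simp: Omega_Conj_iff)

lemma E_mem_iff:
  fixes g :: "('x, 'j::finite) fm"
  assumes "z \<in> Omega"
  shows "E g \<in> z \<longleftrightarrow> (\<forall>j. K j g \<in> z)"
proof -
  have "agents \<noteq> ([] :: 'j list)"
    using agents(2)[where 'j = 'j] by (metis UNIV_not_empty empty_set)
  then have "set agents = insert (hd agents) (set (tl agents) :: 'j set)"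
    by (metis list.collapse list.simps(15))
  then have "UNIV = insert (hd agents) (set (tl agents) :: 'j set)" using agents(2)[where 'j = 'j] by simp
  then have "(\<forall>j. K j g \<in> z) \<longleftrightarrow> (\<forall>j \<in> insert (hd agents) (set (tl agents)). K j g \<in> z)"
    by (metis UNIV_I)
  then show ?thesis by (auto simp: E_def big_conj_mem[OF assms])
qed

lemma Ck_Omega: "z \<in> Ck f \<Longrightarrow> z \<in> Omega"
  by (simp add: Ck_def)

lemma Ck_mem: "z \<in> Ck f \<Longrightarrow> f \<in> z"
  by (metis (mono_tags, lifting) Ck_def funpow_0 mem_Collect_eq)

lemma Ck_sim:
  fixes f :: "('x::countable, 'j::finite) fm"
  assumes "z \<in> Ck f" "sim j z z'"
  shows "z' \<in> Ck f"
proof -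
  have z: "z \<in> Omega" and z': "z' \<in> Omega" using sim_Omega[OF assms(2)] by auto
  have "(E ^^ n) f \<in> z'" for n
  proof -
    have "(E ^^ Suc n) f \<in> z" using assms(1) unfolding Ck_def by blast
    then have "K j ((E ^^ n) f) \<in> z" by (simp add: E_mem_iff[OF z])
    then show ?thesis using sim_K_D[OF assms(2)] by blast
  qed
  then show ?thesis using z' by (simp add: Ck_def)
qed

text \<open>Truth of \<open>f\<close> at all worlds propagates to every \<open>(E ^^ n) f\<close>.
  Surgery therefore has to respect only a subformula-closed set containing \<open>f\<close> in order
  to lead back into \<open>Ck f\<close>.\<close>

lemma fm_theory_Ck:
  fixes f :: "('x::countable, 'j::finite) fm"
  assumes W: "\<And>j. equiv W (R j)" and f: "\<And>w. w \<in> W \<Longrightarrow> sat V R w f" and "w \<in> W"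
  shows "fm_theory V R w \<in> Ck f"
proof -
  have "\<forall>w\<in>W. (E ^^ n) f \<in> fm_theory V R w" for n
  proof (induction n)
    case 0
    then show ?case using f by auto
  next
    case (Suc n)
    show ?case
    proof
      fix w assume w: "w \<in> W"
      have "v \<in> W" if "(w, v) \<in> R j" for v j using that equiv_type[OF W[of j]] by auto
      then have "K j ((E ^^ n) f) \<in> fm_theory V R w" for j using Suc by simp
      then show "(E ^^ Suc n) f \<in> fm_theory V R w"
        by (simp add: E_mem_iff[OF fm_theory_Omega[where R = R, OF W w]] del: mem_fm_theory)
    qed
  qed
  then show ?thesis using assms(3) fm_theory_Omega[where R = R, OF W] by (auto simp: Ck_def)
qed

definition known :: "'j \<Rightarrow> ('x, 'j) fm set \<Rightarrow> ('x, 'j) fm set" where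
  "known j z = {g. K j g \<in> z}"

lemma sim_iff_known: "sim j z z' \<longleftrightarrow> z \<in> Omega \<and> z' \<in> Omega \<and> known j z = known j z'"
  by (auto simp: sim_def known_def)

text \<open>Uniting the possibility sets of \<open>y\<close> and \<open>y'\<close> for agent \<open>j\<close> inside \<open>Ck f\<close>; \<open>t\<close> maps a point to
  its theory in the new model.\<close>

lemma merge_possibility_sets:
  fixes f :: "('x::countable, 'j::finite) fm"
  assumes y: "y \<in> Ck f" "y' \<in> Ck f" and S: "fm_closed S" "f \<in> S"
    and agree: "\<And>g. K j g \<in> S \<Longrightarrow> K j g \<in> y \<longleftrightarrow> K j g \<in> y'"
  obtains t where "\<And>x. x \<in> Ck f \<Longrightarrow> t x \<in> Ck f"
    "\<And>x g. x \<in> Ck f \<Longrightarrow> g \<in> S \<Longrightarrow> g \<in> t x \<longleftrightarrow> g \<in> x"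
    "sim j (t y) (t y')"
    "\<And>a x g. a \<noteq> j \<Longrightarrow> x \<in> Ck f \<Longrightarrow> K a g \<in> t x \<longleftrightarrow> (\<forall>x'. sim a x x' \<longrightarrow> g \<in> t x')"
proof -
  let ?W = "Ck f"
  define l where "l a x = (if a = j \<and> known a x = known a y' then known a y else known a x)"
    for a and x :: "('x, 'j) fm set"
  define R where "R a = {(u, v). u \<in> ?W \<and> v \<in> ?W \<and> l a u = l a v}" for a
  define V where "V w x = (Atom x \<in> w)" for w :: "('x, 'j) fm set" and x
  have W: "equiv ?W (R a)" for a unfolding R_def by (rule equiv_label)
  \<comment> \<open>The relations only grow, so as long as \<open>g\<close> keeps its truth value,
    \<open>K a g\<close> can only turn from true to false. Excluding this is where
    \<open>agree\<close> enters.\<close>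
  have sub: "sim a x x' \<Longrightarrow> x \<in> ?W \<Longrightarrow> (x, x') \<in> R a" for a x x'
    using Ck_sim by (auto simp: R_def l_def sim_iff_known)
  have other: "a \<noteq> j \<Longrightarrow> (x, x') \<in> R a \<longleftrightarrow> x \<in> ?W \<and> sim a x x'" for a x x'
    using Ck_sim by (auto simp: R_def l_def sim_iff_known Ck_Omega)
  have Kiff: "K a g \<in> x \<longleftrightarrow> (\<forall>x'. (x, x') \<in> R a \<longrightarrow> g \<in> x')" if "x \<in> ?W" "K a g \<in> S" for a g x
  proof
    assume r: "\<forall>x'. (x, x') \<in> R a \<longrightarrow> g \<in> x'"
    show "K a g \<in> x" using r sub that(1) K_mem_iff[OF Ck_Omega[OF that(1)]] by blast
  next
    assume k: "K a g \<in> x"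
    show "\<forall>x'. (x, x') \<in> R a \<longrightarrow> g \<in> x'"
    proof (intro allI impI)
      fix x' assume r: "(x, x') \<in> R a"
      then have x': "x' \<in> ?W" by (auto simp: R_def)
      have "K a g \<in> x'"
      proof (cases "a = j")
        case True
        have "K a g \<in> x' \<longleftrightarrow> g \<in> known a x'" for x' by (simp add: known_def)
        moreover have "g \<in> known a y \<longleftrightarrow> g \<in> known a y'" using agree that True by (auto simp: known_def)
        ultimately show ?thesis using r k by (auto simp: R_def l_def split: if_splits)
      next
        case False
        then have "sim a x x'" using r other by simp
          then show ?thesis using sim_K_iff[of a x x' g] k by simp
      qed
      then show "g \<in> x'" using Omega_T[OF Ck_Omega[OF x']] by blast
    qed
  qed
  let ?t = "fm_theory V R"
  have V: "V = (\<lambda>w x. Atom x \<in> id w)" by (simp add: V_def fun_eq_iff)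
  have sat: "sat V R x g \<longleftrightarrow> g \<in> x" if "x \<in> ?W" "g \<in> S" for x g
    using sat_iff_label[where p = id and R = R, OF W _ V S(1) _ that(2,1)]
    by (simp add: Kiff Ck_Omega[of _ f])
  show thesis
  proof (rule that[of ?t])
    show "x \<in> ?W \<Longrightarrow> ?t x \<in> ?W" for x
      by (rule fm_theory_Ck[OF W]) (use sat S(2) Ck_mem in auto)
    show "x \<in> ?W \<Longrightarrow> g \<in> S \<Longrightarrow> g \<in> ?t x \<longleftrightarrow> g \<in> x" for x g using sat by simp
    show "sim j (?t y) (?t y')" using y by (intro fm_theory_sim[OF W]) (auto simp: R_def l_def)
    \<comment> \<open>The relations of agents other than \<open>j\<close> are unchanged, so this
      holds for every \<open>g\<close> and not just within \<open>S\<close>.\<close>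
    show "K a g \<in> ?t x \<longleftrightarrow> (\<forall>x'. sim a x x' \<longrightarrow> g \<in> ?t x')" if "a \<noteq> j" "x \<in> ?W" for a x g
      using other[OF that(1)] that(2) by simp
  qed
qed

text \<open>In two copies of \<open>Ck f\<close>, the points satisfying \<open>q\<close> are moved from the possibility set of \<open>y\<close> for \<open>j\<close>
  in the first copy to the one in the second copy; \<open>y\<close> stays behind as a substitute for them.\<close>

lemma remove_from_possibility_set:
  fixes f :: "('x::countable, 'j::finite) fm"
  assumes y: "y \<in> Ck f" "q \<notin> y" and S: "fm_closed S" "f \<in> S"
    and subst: "\<And>x g. x \<in> Ck f \<Longrightarrow> q \<in> x \<Longrightarrow> K j g \<in> S \<Longrightarrow> g \<in> x \<longleftrightarrow> g \<in> y"
    and q: "\<And>z x. z \<in> Omega \<Longrightarrow> x \<in> Ck f \<Longrightarrow> \<forall>g\<in>S. g \<in> z \<longleftrightarrow> g \<in> x \<Longrightarrow> q \<in> z \<Longrightarrow> q \<in> x"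
  shows "\<exists>y2\<in>Ck f. (\<forall>g\<in>S. g \<in> y2 \<longleftrightarrow> g \<in> y) \<and> K j (Neg q) \<in> y2"
proof -
  let ?W = "Ck f \<times> (UNIV :: bool set)"
  \<comment> \<open>The Boolean names the copy, \<open>True\<close> for the first. For agent
    \<open>j\<close>, points of the possibility set of \<open>y\<close> satisfying \<open>q\<close>
    are labelled \<open>False\<close> in both copies, and so leave the first one.\<close>
  define l where "l a w = (known a (fst w), snd w \<and> \<not> (a = j \<and> sim j y (fst w) \<and> q \<in> fst w))"
    for a and w :: "('x, 'j) fm set \<times> bool"
  define R where "R a = {(u, v). u \<in> ?W \<and> v \<in> ?W \<and> l a u = l a v}" for a
  define V where "V w x = (Atom x \<in> fst w)" for w :: "('x, 'j) fm set \<times> bool" and x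
  have W: "equiv ?W (R a)" for a unfolding R_def by (rule equiv_label)
  have Kiff: "K a g \<in> fst w \<longleftrightarrow> (\<forall>v. (w, v) \<in> R a \<longrightarrow> g \<in> fst v)" if w: "w \<in> ?W" and g: "K a g \<in> S" for a g w
  proof
    assume "K a g \<in> fst w"
    then have "K a g \<in> fst v \<and> fst v \<in> Omega" if "(w, v) \<in> R a" for v
      using that by (auto simp: R_def l_def known_def Ck_Omega)
    then show "\<forall>v. (w, v) \<in> R a \<longrightarrow> g \<in> fst v"
      using Omega_T[of _ a g] by simp
  next
    assume r: "\<forall>v. (w, v) \<in> R a \<longrightarrow> g \<in> fst v"
    have wO: "fst w \<in> Omega" using w Ck_Omega by auto
    have "g \<in> x" if x: "sim a (fst w) x" for x
    proof -
      have xC: "x \<in> Ck f" using Ck_sim[OF _ x] w by auto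
      have kn: "known a (fst w) = known a x" using x by (simp add: sim_iff_known)
      \<comment> \<open>A world carrying \<open>x\<close> is needed with the same copy label as
        \<open>w\<close>. Only points removed from the first copy lack one, and there
        \<open>(y, True)\<close> stands in for them.\<close>
      show ?thesis
      proof (cases "a = j \<and> sim j y x \<and> q \<in> x \<and> snd (l a w)")
        case True
        then have "known j y = known j x" by (simp add: sim_iff_known)
        then have "l a (y, True) = l a w" using True kn y(2) by (auto simp: l_def)
        then have "(w, (y, True)) \<in> R a" using y(1) w by (auto simp: R_def)
        then have "g \<in> y" using r by fastforce
        then show ?thesis using subst[OF xC] True g by blast
      next
        case False
        then have "l a (x, snd (l a w)) = l a w" using kn by (auto simp: l_def)
        then have "(w, (x, snd (l a w))) \<in> R a" using w xC by (auto simp: R_def)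
        then show ?thesis using r by fastforce
      qed
    qed
    then show "K a g \<in> fst w" using K_mem_iff[OF wO] by blast
  qed
  let ?t = "fm_theory V R"
  have V: "V = (\<lambda>w x. Atom x \<in> fst w)" by (simp add: V_def fun_eq_iff)
  have sat: "sat V R w g \<longleftrightarrow> g \<in> fst w" if "w \<in> ?W" "g \<in> S" for w g
    by (rule sat_iff_label[where p = fst and R = R, OF W _ V S(1) _ that(2,1)])
      (use Kiff Ck_Omega in auto)
  show ?thesis
  proof (intro bexI[of _ "?t (y, True)"] conjI ballI)
    show "?t (y, True) \<in> Ck f"
      by (rule fm_theory_Ck[OF W]) (use sat S(2) Ck_mem y in auto)
    show "g \<in> S \<Longrightarrow> g \<in> ?t (y, True) \<longleftrightarrow> g \<in> y" for g using sat y(1) by simp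
    have "\<not> sat V R v q" if v: "((y, True), v) \<in> R j" for v
    proof
      assume "sat V R v q"
      have vW: "v \<in> ?W" using v by (auto simp: R_def)
      have "q \<in> fst v"
        using q[OF fm_theory_Omega[where R = R and V = V, OF W vW], of "fst v"] sat[OF vW] vW \<open>sat V R v q\<close> by auto
      moreover have "sim j y (fst v)"
        using v vW y(1) Ck_Omega by (auto simp: R_def l_def sim_iff_known)
      ultimately show False using v y(2) by (auto simp: R_def l_def)
    qed
    then show "K j (Neg q) \<in> ?t (y, True)" by simp
  qed
qed


section \<open>Cells and density\<close>

primrec agent_path :: "'j list \<Rightarrow> ('x, 'j) fm set \<Rightarrow> ('x, 'j) fm set \<Rightarrow> bool" where
  "agent_path [] z z' \<longleftrightarrow> z \<in> Omega \<and> z = z'"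
| "agent_path (j # w) z z' \<longleftrightarrow> (\<exists>y. sim j z y \<and> agent_path w y z')"

definition component :: "('x, 'j) fm set \<Rightarrow> ('x, 'j) fm set set" where
  "component z = {z'. \<exists>w. agent_path w z z'}"

lemma agent_path_Omega: "agent_path w z z' \<Longrightarrow> z \<in> Omega \<and> z' \<in> Omega"
  by (induction w arbitrary: z) (auto simp: sim_Omega)

lemma agent_path_append: "agent_path w z y \<Longrightarrow> agent_path w' y z' \<Longrightarrow> agent_path (w @ w') z z'"
  by (induction w arbitrary: z) auto

lemma agent_path_single: "sim j z z' \<Longrightarrow> agent_path [j] z z'"
  by (auto simp: sim_Omega)

lemma agent_path_rev: "agent_path w z z' \<Longrightarrow> agent_path (rev w) z' z"
proof (induction w arbitrary: z)
  case (Cons j w)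
  then obtain y where y: "sim j z y" "agent_path w y z'" by auto
  show ?case using agent_path_append[OF Cons.IH[OF y(2)] agent_path_single[OF sim_sym[OF y(1)]]] by simp
qed auto

lemma component_refl: "z \<in> Omega \<Longrightarrow> z \<in> component z"
  unfolding component_def by (intro CollectI exI[of _ "[]"]) simp

lemma component_eq:
  assumes "z' \<in> component z"
  shows "component z' = component z"
proof -
  obtain w where w: "agent_path w z z'" using assms by (auto simp: component_def)
  show ?thesis
    using agent_path_append[OF w] agent_path_append[OF agent_path_rev[OF w]]
    unfolding component_def by blast
qed

lemma component_sim: "y \<in> component z \<Longrightarrow> sim j y y' \<Longrightarrow> y' \<in> component z"
proof -
  assume "y \<in> component z" and s: "sim j y y'"
  then obtain w where "agent_path w z y" by (auto simp: component_def)
  then have "agent_path (w @ [j]) z y'" using agent_path_append agent_path_single[OF s] by blast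
  then show ?thesis unfolding component_def by blast
qed

lemma Q_closed_iff: "Q_closed C \<longleftrightarrow> (\<forall>j y z. sim j y z \<longrightarrow> y \<in> C \<longrightarrow> z \<in> C)"
proof
  assume C: "Q_closed C"
  show "\<forall>j y z. sim j y z \<longrightarrow> y \<in> C \<longrightarrow> z \<in> C"
  proof (intro allI impI)
    fix j y z assume s: "sim j y z" and y: "y \<in> C"
    have "{x. sim j y x} \<in> Q j" using sim_Omega(1)[OF s] by (auto simp: Q_eq)
    moreover have "y \<in> {x. sim j y x} \<inter> C" using sim_refl[OF sim_Omega(1)[OF s]] y by simp
    ultimately have "{x. sim j y x} \<subseteq> C" using C unfolding Q_closed_def by (metis empty_iff)
    then show "z \<in> C" using s by blast
  qed
next
  assume C: "\<forall>j y z. sim j y z \<longrightarrow> y \<in> C \<longrightarrow> z \<in> C"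
  show "Q_closed C"
    unfolding Q_closed_def Q_eq
  proof (intro allI ballI impI)
    fix j P assume "P \<in> {{z'. sim j z z'} |z. z \<in> Omega}" and ne: "P \<inter> C \<noteq> {}"
    then obtain z where P: "P = {z'. sim j z z'}" by blast
    obtain y where "sim j z y" "y \<in> C" using ne P by blast
    have "z' \<in> C" if "sim j z z'" for z'
      using C sim_trans[OF sim_sym[OF \<open>sim j z y\<close>] that] \<open>y \<in> C\<close> by blast
    then show "P \<subseteq> C" using P by blast
  qed
qed

lemma Q_closed_agent_path:
  assumes "Q_closed C" "agent_path w z z'" "z \<in> C"
  shows "z' \<in> C"
  using assms(2,3)
proof (induction w arbitrary: z)
  case (Cons j w)
  then obtain y where y: "sim j z y" "agent_path w y z'" by auto
  then have "y \<in> C" using assms(1) Cons.prems(2) unfolding Q_closed_iff by blast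
  then show ?case using Cons.IH[OF y(2)] by blast
qed simp

text \<open>A \<open>Q_closed\<close> set contains every point reachable from its members, so the
  minimal ones are exactly the sets reachable from one point.\<close>

lemma cell_iff_component: "cell C \<longleftrightarrow> (\<exists>z\<in>Omega. C = component z)"
proof
  assume C: "cell C"
  then have C': "C \<noteq> {}" "C \<subseteq> Omega" "Q_closed C"
    and min: "\<And>D. D \<noteq> {} \<Longrightarrow> D \<subseteq> C \<Longrightarrow> Q_closed D \<Longrightarrow> D = C"
    unfolding cell_def by simp_all
  then obtain z where z: "z \<in> C" "z \<in> Omega" by blast
  have "component z \<subseteq> C"
    using Q_closed_agent_path[OF C'(3) _ z(1)] unfolding component_def by blast
  moreover have "component z \<noteq> {}" using component_refl[OF z(2)] by blast
  moreover have "Q_closed (component z)" by (simp add: Q_closed_iff component_sim)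
  ultimately have "component z = C" by (intro min)
  then show "\<exists>z\<in>Omega. C = component z" using z(2) by blast
next
  assume "\<exists>z\<in>Omega. C = component z"
  then obtain z where z: "z \<in> Omega" and C: "C = component z" by blast
  have "D = C" if D: "D \<noteq> {}" "D \<subseteq> C" "Q_closed D" for D
  proof -
    obtain y where y: "y \<in> D" using D(1) by blast
    then have "component y = component z" using D(2) C component_eq by blast
    then have "C \<subseteq> D" using Q_closed_agent_path[OF D(3) _ y] C unfolding component_def by blast
    then show ?thesis using D(2) by blast
  qed
  moreover have "Q_closed C" by (simp add: Q_closed_iff C component_sim)
  moreover have "C \<subseteq> Omega" by (auto simp: C component_def dest: agent_path_Omega)
  moreover have "C \<noteq> {}" using component_refl[OF z] C by blast
  ultimately show "cell C" unfolding cell_def by (intro conjI allI impI) (assumption | blast)+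
qed

lemma cell_eq_component:
  assumes "cell C" "z \<in> C"
  shows "C = component z"
proof -
  obtain y where "C = component y" using assms(1) unfolding cell_iff_component by blast
  then show ?thesis using component_eq[of z y] assms(2) by simp
qed

section \<open>Topology and reachability in terms of formulas\<close>

lemma openin_Omega_top_iff:
  fixes U :: "('x, 'j) fm set set"
  shows "openin Omega_top U \<longleftrightarrow>
    U \<subseteq> Omega \<and> (\<forall>z\<in>U. \<exists>g. g \<in> z \<and> {z' \<in> Omega. g \<in> z'} \<subseteq> U)" (is "_ \<longleftrightarrow> ?r")
proof
  assume "openin Omega_top U"
  then obtain \<U> where "\<U> \<subseteq> range (\<lambda>g. {z \<in> Omega. g \<in> z})" "\<Union>\<U> = U"
    unfolding openin_Omega_top union_of_def by blast
  then show ?r by blast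
next
  assume r: ?r
  let ?\<U> = "{V \<in> range (\<lambda>g. {z \<in> Omega. g \<in> z}). V \<subseteq> U}"
  have "U \<subseteq> \<Union>?\<U>"
  proof
    fix z assume z: "z \<in> U"
    then obtain g where "g \<in> z" "{z' \<in> Omega. g \<in> z'} \<subseteq> U" using r by blast
    moreover have "z \<in> Omega" using r z by blast
    ultimately show "z \<in> \<Union>?\<U>" by blast
  qed
  then have "\<Union>?\<U> = U" by blast
  moreover have "?\<U> \<subseteq> {V. V \<in> range (\<lambda>g. {z \<in> Omega. g \<in> z})}" by simp
  ultimately show "openin Omega_top U"
    unfolding openin_Omega_top union_of_def arbitrary_def
    by (intro exI[of _ ?\<U>] conjI TrueI)
qed

lemma dense_in_Ck_iff:
  fixes f :: "('x, 'j::finite) fm"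
  shows "dense_in_Ck C f \<longleftrightarrow> C \<subseteq> Ck f \<and> (\<forall>y\<in>Ck f. \<forall>g\<in>y. \<exists>z\<in>C. g \<in> z)"
  unfolding dense_in_Ck_def
proof (rule conj_cong[OF refl])
  assume C: "C \<subseteq> Ck f"
  let ?X = "subtopology Omega_top (Ck f)"
  have op: "openin Omega_top {z \<in> Omega. g \<in> z}" for g :: "('x, 'j) fm"
    by (auto simp: openin_Omega_top_iff)
  have "openin Omega_top (Omega :: ('x, 'j) fm set set)"
    by (auto simp: openin_Omega_top_iff Omega_def complete_fms_def)
  then have top: "topspace ?X = Ck f"
    using openin_subset openin_Omega_top_iff Ck_Omega
    by (metis (no_types, lifting) inf.absorb2 openin_topspace subsetI subset_antisym topspace_subtopology)
  show "?X closure_of C = Ck f \<longleftrightarrow> (\<forall>y\<in>Ck f. \<forall>g\<in>y. \<exists>z\<in>C. g \<in> z)"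
  proof
    assume cl: "?X closure_of C = Ck f"
    show "\<forall>y\<in>Ck f. \<forall>g\<in>y. \<exists>z\<in>C. g \<in> z"
    proof (intro ballI)
      fix y g assume y: "y \<in> Ck f" and g: "g \<in> y"
      have op': "openin ?X (Ck f \<inter> {z \<in> Omega. g \<in> z})" using op by (rule openin_subtopology_Int2)
      have "y \<in> ?X closure_of C" using cl y by simp
      have "\<forall>T. y \<in> T \<and> openin ?X T \<longrightarrow> (\<exists>z. z \<in> C \<and> z \<in> T)"
        using \<open>y \<in> ?X closure_of C\<close> unfolding in_closure_of by (rule conjunct2)
      from this[rule_format, OF conjI, OF _ op']
      have "\<exists>z. z \<in> C \<and> z \<in> Ck f \<inter> {z \<in> Omega. g \<in> z}" using y g Ck_Omega[OF y] by simp
      then show "\<exists>z\<in>C. g \<in> z" by auto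
    qed
  next
    assume d: "\<forall>y\<in>Ck f. \<forall>g\<in>y. \<exists>z\<in>C. g \<in> z"
    have "y \<in> ?X closure_of C" if y: "y \<in> Ck f" for y
      unfolding in_closure_of top
    proof (intro conjI allI impI)
      fix T assume T: "y \<in> T \<and> openin ?X T"
      then obtain U where U: "openin Omega_top U" "T = U \<inter> Ck f" by (auto simp: openin_subtopology)
      then obtain g where "g \<in> y" "{z \<in> Omega. g \<in> z} \<subseteq> U"
        using T unfolding openin_Omega_top_iff by blast
      moreover obtain z where "z \<in> C" "g \<in> z" using d y \<open>g \<in> y\<close> by blast
      moreover have "z \<in> Ck f" "z \<in> Omega" using \<open>z \<in> C\<close> C Ck_Omega[of z f] by auto
      ultimately show "\<exists>z. z \<in> C \<and> z \<in> T" using U(2) by blast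
    qed (rule y)
    then have "Ck f \<subseteq> ?X closure_of C" by (rule subsetI)
    moreover have "?X closure_of C \<subseteq> Ck f" using closure_of_subset_topspace[of ?X C] top by simp
    ultimately show "?X closure_of C = Ck f" by (rule subset_antisym[rotated])
  qed
qed

text \<open>Iterated \<open>K\<close> along \<open>w\<close> is the box operator of the relation
  \<open>agent_path w\<close>; this makes reachability along a fixed word expressible.\<close>

lemma foldr_K_mem_iff:
  fixes g :: "('x::countable, 'j::countable) fm"
  assumes "z \<in> Omega"
  shows "foldr K w g \<in> z \<longleftrightarrow> (\<forall>z'. agent_path w z z' \<longrightarrow> g \<in> z')"
  using assms
proof (induction w arbitrary: z)
  case (Cons j w)
  have "foldr K w g \<in> y \<longleftrightarrow> (\<forall>z'. agent_path w y z' \<longrightarrow> g \<in> z')" if "sim j z y" for y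
    using Cons.IH[OF sim_Omega(2)[OF that]] .
  then have "foldr K (j # w) g \<in> z \<longleftrightarrow> (\<forall>y. sim j z y \<longrightarrow> (\<forall>z'. agent_path w y z' \<longrightarrow> g \<in> z'))"
    using K_mem_iff[OF Cons.prems, of j "foldr K w g"] by simp
  also have "\<dots> \<longleftrightarrow> (\<forall>z'. agent_path (j # w) z z' \<longrightarrow> g \<in> z')" unfolding agent_path.simps by blast
  finally show ?case .
qed simp

lemma finite_conjunction:
  fixes H :: "('x::countable, 'j::countable) fm set"
  assumes "finite H"
  shows "\<exists>c. \<forall>z\<in>Omega. c \<in> z \<longleftrightarrow> H \<subseteq> z"
  using assms
proof (induction H)
  case empty
  have "Neg (Conj g (Neg g)) \<in> z" if "z \<in> Omega" for z and g :: "('x, 'j) fm"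
    by (simp add: Omega_simps[OF that])
  then show ?case by auto
next
  case (insert g H)
  then obtain c where "\<forall>z\<in>Omega. c \<in> z \<longleftrightarrow> H \<subseteq> z" by blast
  then have "\<forall>z\<in>Omega. Conj g c \<in> z \<longleftrightarrow> insert g H \<subseteq> z" by (simp add: Omega_Conj_iff)
  then show ?case by blast
qed

text \<open>Closedness of reachability in the product: the two formulas define neighbourhoods of
  \<open>z'\<close> and of \<open>z\<close> between which no path labelled \<open>w\<close> runs.
  Like any composition of closed relations, it rests on compactness of the intermediate
  space.\<close>

lemma agent_path_closed:
  fixes z :: "('x::countable, 'j::countable) fm set"
  assumes "z \<in> Omega" "z' \<in> Omega" "\<not> agent_path w z z'"
  obtains h where "h \<in> z'" "foldr K w (Neg h) \<in> z"
proof -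
  have "agent_path w z z'" if "\<And>h. h \<in> z' \<Longrightarrow> foldr K w (Neg h) \<notin> z"
    using that assms(1)
  proof (induction w arbitrary: z)
    case Nil
    have "h \<in> z'" if "h \<in> z" for h
      using that Nil(1)[of "Neg h"] by (auto simp: Omega_Neg_iff[OF assms(2)] Omega_Neg_iff[OF Nil(2)])
    moreover have "h \<in> z" if "h \<in> z'" for h
      using that Nil(1)[of h] by (auto simp: Omega_Neg_iff[OF Nil(2)])
    ultimately show ?case using Nil(2) by auto
  next
    case (Cons j w)
    \<comment> \<open>What the first intermediate point must satisfy for the induction hypothesis:
      it may not exclude \<open>h\<close> along \<open>w\<close> for any \<open>h \<in> z'\<close>.
      Finitely many such demands follow from the single one for the conjunction
      \<open>c\<close>.\<close>
    let ?T = "(\<lambda>h. Neg (foldr K w (Neg h))) ` z'"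
    have fin: "\<exists>y. sim j z y \<and> S \<subseteq> y" if S: "finite S" "S \<subseteq> ?T" for S
    proof -
      obtain H where H: "H \<subseteq> z'" "finite H" "S = (\<lambda>h. Neg (foldr K w (Neg h))) ` H"
        using finite_subset_image[OF S] by blast
      obtain c where c: "\<And>z. z \<in> Omega \<Longrightarrow> c \<in> z \<longleftrightarrow> H \<subseteq> z" using finite_conjunction[OF H(2)] by blast
      have "K j (foldr K w (Neg c)) \<notin> z" using Cons.prems(1)[of c] c[OF assms(2)] H(1) by simp
      then obtain y where y: "sim j z y" "foldr K w (Neg c) \<notin> y"
        using K_mem_iff[OF Cons.prems(2)] by blast
      have yO: "y \<in> Omega" using sim_Omega(2)[OF y(1)] .
      obtain x where x: "agent_path w y x" "Neg c \<notin> x" using y(2) foldr_K_mem_iff[OF yO] by blast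
      have xO: "x \<in> Omega" using agent_path_Omega[OF x(1)] by blast
      have "H \<subseteq> x" using x(2) Omega_Neg_iff[OF xO] c[OF xO] by blast
      then have "foldr K w (Neg h) \<notin> y" if "h \<in> H" for h
        using that x(1) foldr_K_mem_iff[OF yO, of w "Neg h"] Omega_Neg_iff[OF xO, of h] by blast
      then have "S \<subseteq> y" using H(3) Omega_Neg_iff[OF yO] by auto
      then show ?thesis using y(1) by blast
    qed
    obtain y where y: "sim j z y" "?T \<subseteq> y" using sim_compact[OF fin Cons.prems(2)] by blast
    have yO: "y \<in> Omega" using sim_Omega(2)[OF y(1)] .
    have "agent_path w y z'"
      by (rule Cons.IH) (use y(2) yO Omega_Neg_iff[OF yO] in auto)
    then show ?case using y(1) by auto
  qed
  then show thesis using that assms(3) by blast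
qed


section \<open>Splitting points within a possibility set\<close>

primrec subfm :: "('x, 'j) fm \<Rightarrow> ('x, 'j) fm set" where
  "subfm (Atom x) = {Atom x}"
| "subfm (Neg g) = insert (Neg g) (subfm g)"
| "subfm (Conj g h) = insert (Conj g h) (subfm g \<union> subfm h)"
| "subfm (K j g) = insert (K j g) (subfm g)"

lemma subfm_self: "g \<in> subfm g"
  by (cases g) auto

lemma finite_subfm: "finite (subfm g)"
  by (induction g) auto

lemma subfm_trans: "h \<in> subfm g \<Longrightarrow> subfm h \<subseteq> subfm g"
  by (induction g) auto

lemma fm_closed_Union_subfm: "fm_closed (\<Union>g\<in>S. subfm g)"
proof -
  have "g \<in> subfm k" if "Neg g \<in> subfm k" for g k :: "('x, 'j) fm"
    using subfm_trans[OF that] subfm_self[of g] by auto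
  moreover have "g \<in> subfm k" "h \<in> subfm k" if "Conj g h \<in> subfm k" for g h k :: "('x, 'j) fm"
    using subfm_trans[OF that] subfm_self[of g] subfm_self[of h] by auto
  moreover have "g \<in> subfm k" if "K j g \<in> subfm k" for g k :: "('x, 'j) fm" and j
    using subfm_trans[OF that] subfm_self[of g] by auto
  ultimately show ?thesis unfolding fm_closed_def UN_iff by metis
qed

text \<open>Descending in \<open>g\<close> while staying outside \<open>S\<close> cannot stop at a
  Boolean connective, since \<open>S\<close> is closed under these; it stops at an atom or at a
  \<open>K\<close> whose body is in \<open>S\<close>.\<close>

lemma minimal_outside:
  assumes "g \<notin> S" and "\<And>g. g \<in> S \<Longrightarrow> Neg g \<in> S" and "\<And>g h. g \<in> S \<Longrightarrow> h \<in> S \<Longrightarrow> Conj g h \<in> S"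
  obtains u where "u \<notin> S" "(\<exists>x. u = Atom x) \<or> (\<exists>a h. u = K a h \<and> h \<in> S)"
proof -
  have "\<exists>u. u \<notin> S \<and> ((\<exists>x. u = Atom x) \<or> (\<exists>a h. u = K a h \<and> h \<in> S))"
    using assms(1)
  proof (induction g)
    case (Neg g)
    then show ?case using assms(2)[of g] by metis
  next
    case (Conj g h)
    then show ?case using assms(3)[of g h] by metis
  qed metis+
  then show thesis using that by metis
qed

text \<open>Any two non-empty basic open sets of \<open>Ck f\<close> contain points, one from each
  of \<open>C1\<close> and \<open>C2\<close>, that no word of agents connects.\<close>

locale several_dense_cells =
  fixes f :: "('x::finite, 'j::finite) fm" and C1 C2 :: "('x, 'j) fm set set"
  assumes agents_ge_2: "CARD('j) \<ge> 2"
    and cells: "cell C1" "cell C2" "C1 \<noteq> C2"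
    and dense: "dense_in_Ck C1 f" "dense_in_Ck C2 f"
begin

lemma dense_meets: "y \<in> Ck f \<Longrightarrow> g \<in> y \<Longrightarrow> \<exists>z\<in>C1. g \<in> z" "y \<in> Ck f \<Longrightarrow> g \<in> y \<Longrightarrow> \<exists>z\<in>C2. g \<in> z"
  using dense unfolding dense_in_Ck_iff by simp_all

lemma cells_Ck: "z \<in> C1 \<Longrightarrow> z \<in> Ck f" "z \<in> C2 \<Longrightarrow> z \<in> Ck f"
  using dense unfolding dense_in_Ck_iff by auto

lemma component_neq: "y \<in> C1 \<Longrightarrow> y' \<in> C2 \<Longrightarrow> component y \<noteq> component y'"
  using cells cell_eq_component by metis

lemma no_isolated_point:
  assumes "y \<in> Ck f" "g \<in> y"
  obtains z z' where "z \<in> Ck f" "z' \<in> Ck f" "g \<in> z" "g \<in> z'" "z \<noteq> z'"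
proof -
  obtain z z' where z: "z \<in> C1" "g \<in> z" "z' \<in> C2" "g \<in> z'" using dense_meets assms by metis
  then have "z \<noteq> z'" using component_neq by metis
  then show thesis using that z cells_Ck by metis
qed

text \<open>Two points satisfying \<open>e\<close> and agreeing on \<open>e\<close> and \<open>f\<close> with all their subformulas are distinguished by some
  minimal formula \<open>u\<close>. Unless \<open>u\<close> is about the knowledge of \<open>j\<close>, uniting their possibility sets for \<open>j\<close>
  keeps them distinct. Otherwise there are points that disagree on \<open>u\<close> only because of the knowledge
  of \<open>j\<close>, and another agent \<open>j'\<close> may or may not consider \<open>u\<close> possible; this is a distinction that
  uniting the possibility sets for \<open>j\<close> preserves.\<close>

lemma split_possibility_set:
  assumes y0: "y0 \<in> Ck f" "e \<in> y0"
  obtains z1 z2 where "z1 \<in> Ck f" "z2 \<in> Ck f" "e \<in> z1" "e \<in> z2" "sim j z1 z2" "z1 \<noteq> z2"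
proof -
  define S0 where "S0 = (\<Union>g\<in>{e, f}. subfm g)"
  have S0: "finite S0" "e \<in> S0" "f \<in> S0" by (auto simp: S0_def finite_subfm subfm_self)
  have "finite ((S0 \<inter> y0) \<union> Neg ` (S0 - y0))" using S0(1) by simp
  then obtain c where c': "\<And>z. z \<in> Omega \<Longrightarrow> c \<in> z \<longleftrightarrow> (S0 \<inter> y0) \<union> Neg ` (S0 - y0) \<subseteq> z"
    using finite_conjunction by metis
  have c: "c \<in> z \<longleftrightarrow> (\<forall>g\<in>S0. g \<in> z \<longleftrightarrow> g \<in> y0)" if "z \<in> Omega" for z
    unfolding c'[OF that] using Omega_Neg_iff[OF that] by auto
  \<comment> \<open>\<open>c\<close> fixes the truth values on \<open>S0\<close> as at
    \<open>y0\<close>, so \<open>N\<close> is a clopen neighbourhood on which \<open>e\<close> holds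
    throughout.\<close>
  define N where "N = {x \<in> Ck f. c \<in> x}"
  have NO: "x \<in> Omega" if "x \<in> N" for x using that Ck_Omega by (auto simp: N_def)
  have N_S0: "g \<in> x \<longleftrightarrow> g \<in> y0" if "x \<in> N" "g \<in> S0" for x g
    using c[OF NO[OF that(1)]] that by (auto simp: N_def)
  have N_I: "z \<in> N" if "z \<in> Ck f" "x \<in> N" "\<And>g. g \<in> S0 \<Longrightarrow> g \<in> z \<longleftrightarrow> g \<in> x" for z x
    using c[OF Ck_Omega[OF that(1)]] N_S0[OF that(2)] that(1,3) by (auto simp: N_def)
  have y0N: "y0 \<in> N" using y0(1) c[OF Ck_Omega[OF y0(1)]] by (simp add: N_def)
  have eN: "e \<in> x" if "x \<in> N" for x using N_S0[OF that S0(2)] y0(2) by simp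
  define agree where "agree = (\<lambda>g. \<forall>x\<in>N. \<forall>x'\<in>N. g \<in> x \<longleftrightarrow> g \<in> x')"
  \<comment> \<open>Formulas all of whose subformulas are constant on \<open>N\<close>. The
    hereditary form makes \<open>P\<close> subformula-closed; as \<open>N\<close> has two points,
    some formula is not in \<open>P\<close>.\<close>
  define P where "P = {g. \<forall>h\<in>subfm g. agree h}"
  have P_agree: "g \<in> x \<longleftrightarrow> g \<in> x'" if "g \<in> P" "x \<in> N" "x' \<in> N" for g x x'
  proof -
    have "agree g" using that(1) subfm_self[of g] unfolding P_def by blast
    then show ?thesis using that(2,3) unfolding agree_def by blast
  qed
  have P_subfm: "subfm g \<subseteq> P" if "g \<in> P" for g
    using that subfm_trans unfolding P_def by blast
  then have "P = (\<Union>g\<in>P. subfm g)" using subfm_self by blast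
  then have P_closed: "fm_closed P" using fm_closed_Union_subfm[of P] by simp
  have "agree g" if "g \<in> S0" for g using N_S0[OF _ that] unfolding agree_def by simp
  moreover have "subfm g \<subseteq> S0" if "g \<in> S0" for g using that subfm_trans[of g] unfolding S0_def by blast
  ultimately have S0P: "S0 \<subseteq> P" unfolding P_def by blast
  have "c \<in> y0" using y0N by (simp add: N_def)
  then obtain z z' where "z \<in> N" "z' \<in> N" "z \<noteq> z'"
    using no_isolated_point[OF y0(1)] unfolding N_def by (metis (mono_tags, lifting) mem_Collect_eq)
  then obtain g where "\<not> agree g" unfolding agree_def by (metis subsetI subset_antisym)
  then have "g \<notin> P" using subfm_self[of g] unfolding P_def by blast
  moreover have "Neg g \<in> P" if "g \<in> P" for g
  proof -
    have "Neg g \<in> x \<longleftrightarrow> Neg g \<in> x'" if "x \<in> N" "x' \<in> N" for x x'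
      using P_agree[OF \<open>g \<in> P\<close> that] that by (simp add: Omega_Neg_iff NO)
    then have "agree (Neg g)" unfolding agree_def by blast
    then show ?thesis using that by (simp add: P_def)
  qed
  moreover have "Conj g h \<in> P" if "g \<in> P" "h \<in> P" for g h
  proof -
    have "Conj g h \<in> x \<longleftrightarrow> Conj g h \<in> x'" if "x \<in> N" "x' \<in> N" for x x'
      using P_agree[OF \<open>g \<in> P\<close> that] P_agree[OF \<open>h \<in> P\<close> that] that by (simp add: Omega_Conj_iff NO)
    then have "agree (Conj g h)" unfolding agree_def by blast
    then show ?thesis using that by (auto simp: P_def)
  qed
  ultimately obtain u where u: "u \<notin> P" "(\<exists>x. u = Atom x) \<or> (\<exists>a h. u = K a h \<and> h \<in> P)"
    by (rule minimal_outside)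
  have "\<not> agree u"
  proof
    assume "agree u"
    moreover have "agree k" if "k \<in> subfm h" "h \<in> P" for k h using that by (simp add: P_def)
    ultimately have "u \<in> P" using u(2) by (auto simp: P_def)
    then show False using u(1) by simp
  qed
  then obtain y y' where y: "y \<in> N" "y' \<in> N" "u \<notin> y" "u \<in> y'" unfolding agree_def by metis
  define S where "S = insert u P"
  have S_closed: "fm_closed S"
    using P_closed u(2) unfolding S_def fm_closed_def by (metis fm.distinct fm.inject(4) insert_iff)
  have fS: "f \<in> S" and uS: "u \<in> S" using S0(3) S0P by (auto simp: S_def)
  have S_S0: "g \<in> S" if "g \<in> S0" for g using that S0P by (auto simp: S_def)
  have yC: "y \<in> Ck f" "y' \<in> Ck f" using y(1,2) by (auto simp: N_def)
  have agree_K: "K a g \<in> x \<longleftrightarrow> K a g \<in> x'"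
    if "\<nexists>h. u = K a h" "x \<in> N" "x' \<in> N" "K a g \<in> S" for a g x x'
    using P_agree[OF _ that(2,3), of "K a g"] that(1,4) by (auto simp: S_def)
  show thesis
  proof (cases "\<exists>h. u = K j h")
    case False
    obtain t where t: "\<And>x. x \<in> Ck f \<Longrightarrow> t x \<in> Ck f"
        "\<And>x g. x \<in> Ck f \<Longrightarrow> g \<in> S \<Longrightarrow> g \<in> t x \<longleftrightarrow> g \<in> x" "sim j (t y) (t y')"
      using merge_possibility_sets[OF yC S_closed fS agree_K[OF False y(1,2)]] by metis
    have "u \<notin> t y" "u \<in> t y'" using t(2) yC uS y(3,4) by auto
    moreover have "e \<in> t y" "e \<in> t y'" using t(2)[OF _ S_S0[OF S0(2)]] yC eN y(1,2) by auto
    ultimately show thesis using that[of "t y" "t y'"] t yC by metis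
  next
    case True
    then obtain h where h: "u = K j h" "h \<in> P" using u(2) by auto
    have "\<exists>j'. j' \<noteq> j"
    proof (rule ccontr)
      assume "\<nexists>j'. j' \<noteq> j"
      then have "(UNIV :: 'j set) = {j}" by auto
      then have "CARD('j) = 1" by (rule ssubst) simp
      then show False using agents_ge_2 by simp
    qed
    then obtain j' where j': "j' \<noteq> j" by auto
    then have nu: "\<nexists>h. u = K j' h" using h(1) by simp
    \<comment> \<open>Membership in \<open>N\<close> together with \<open>u\<close>. Its truth is
      determined by that of formulas in \<open>S\<close>, so every surgery respecting
      \<open>S\<close> respects \<open>q\<close> as well.\<close>
    define q where "q = Conj c u"
    have q_iff: "q \<in> z \<longleftrightarrow> q \<in> x" if "z \<in> Omega" "x \<in> Omega" "\<And>g. g \<in> S \<Longrightarrow> g \<in> z \<longleftrightarrow> g \<in> x" for z x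
      using that(3)[OF uS] that(3)[OF S_S0]
      by (simp add: q_def Omega_Conj_iff[OF that(1)] Omega_Conj_iff[OF that(2)] c[OF that(1)] c[OF that(2)])
    obtain t where t: "\<And>x. x \<in> Ck f \<Longrightarrow> t x \<in> Ck f"
        "\<And>x g. x \<in> Ck f \<Longrightarrow> g \<in> S \<Longrightarrow> g \<in> t x \<longleftrightarrow> g \<in> x" "sim j' (t y) (t y')"
      using merge_possibility_sets[OF yC S_closed fS agree_K[OF nu y(1,2)]] by metis
    \<comment> \<open>Neither \<open>y1\<close> nor the later \<open>y2\<close> satisfies
      \<open>u\<close>, but for \<open>y1\<close> the other agent \<open>j'\<close> considers
      \<open>q\<close> possible, with witness \<open>t y'\<close>, while at \<open>y2\<close> this
      agent knows \<open>Neg q\<close>.\<close>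
    define y1 where "y1 = t y"
    have y1: "y1 \<in> Ck f" "y1 \<in> N" "u \<notin> y1"
      using t(1)[OF yC(1)] N_I[OF t(1)[OF yC(1)] y(1)] t(2)[OF yC(1)] S_S0 uS y(3) by (auto simp: y1_def)
    have "q \<in> y'" using y(2,4) Omega_Conj_iff[OF NO[OF y(2)]] by (simp add: q_def N_def)
    then have "q \<in> t y'"
      using q_iff[OF Ck_Omega[OF t(1)[OF yC(2)]] NO[OF y(2)] t(2)[OF yC(2)]] by simp
    then have q1: "K j' (Neg q) \<notin> y1"
      using sim_K_D[OF t(3), of "Neg q"] Omega_Neg_iff[OF sim_Omega(2)[OF t(3)]] by (auto simp: y1_def)
    have qD: "x \<in> N" "u \<in> x" if "x \<in> Ck f" "q \<in> x" for x
      using that Omega_Conj_iff[OF Ck_Omega[OF that(1)]] by (auto simp: q_def N_def)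
    have q1': "q \<notin> y" using qD(2)[OF yC(1)] y(3) by blast
    \<comment> \<open>Here \<open>y\<close> can substitute for the removed points: they all lie in
      \<open>N\<close>, where \<open>g\<close>, as an element of \<open>P\<close>, is
      constant.\<close>
    have q2: "g \<in> x \<longleftrightarrow> g \<in> y" if "x \<in> Ck f" "q \<in> x" "K j' g \<in> S" for x g
    proof -
      have "K j' g \<in> P" using that(3) nu by (auto simp: S_def)
      then have "g \<in> P" using fm_closedD(4)[OF P_closed] by blast
      then show ?thesis using P_agree qD(1)[OF that(1,2)] y(1) by blast
    qed
    have q3: "q \<in> x" if "z \<in> Omega" "x \<in> Ck f" "\<forall>g\<in>S. g \<in> z \<longleftrightarrow> g \<in> x" "q \<in> z" for z x
      using q_iff[OF that(1) Ck_Omega[OF that(2)]] that(3,4) by blast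
    have "\<exists>y2\<in>Ck f. (\<forall>g\<in>S. g \<in> y2 \<longleftrightarrow> g \<in> y) \<and> K j' (Neg q) \<in> y2"
      by (rule remove_from_possibility_set[OF yC(1) q1' S_closed fS]; (rule q2 | rule q3); assumption)
    then obtain y2 where y2: "y2 \<in> Ck f" "\<And>g. g \<in> S \<Longrightarrow> g \<in> y2 \<longleftrightarrow> g \<in> y" "K j' (Neg q) \<in> y2"
      by metis
    have y2N: "y2 \<in> N" "u \<notin> y2" using N_I[OF y2(1) y(1)] y2(2) S_S0 uS y(3) by auto
    \<comment> \<open>The only formula of \<open>S\<close> that may lie outside \<open>P\<close> is
      \<open>u\<close>, and it fails at both points; so they may be merged for
      \<open>j\<close>.\<close>
    have agr: "K j g \<in> y1 \<longleftrightarrow> K j g \<in> y2" if "K j g \<in> S" for g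
      using P_agree[OF _ y1(2) y2N(1), of "K j g"] that y1(3) y2N(2) by (auto simp: S_def)
    show thesis
    proof (rule merge_possibility_sets[OF y1(1) y2(1) S_closed fS agr])
      fix s
      assume s: "\<And>x. x \<in> Ck f \<Longrightarrow> s x \<in> Ck f"
          "\<And>x g. x \<in> Ck f \<Longrightarrow> g \<in> S \<Longrightarrow> g \<in> s x \<longleftrightarrow> g \<in> x" "sim j (s y1) (s y2)"
          "\<And>a x g. a \<noteq> j \<Longrightarrow> x \<in> Ck f \<Longrightarrow> K a g \<in> s x \<longleftrightarrow> (\<forall>x'. sim a x x' \<longrightarrow> g \<in> s x')"
      have Neg_q: "Neg q \<in> s x \<longleftrightarrow> Neg q \<in> x" if "x \<in> Ck f" for x
        using q_iff[OF Ck_Omega[OF s(1)[OF that]] Ck_Omega[OF that] s(2)[OF that]]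
          Omega_Neg_iff[OF Ck_Omega[OF s(1)[OF that]]] Omega_Neg_iff[OF Ck_Omega[OF that]] by simp
      have "K j' (Neg q) \<in> s x \<longleftrightarrow> K j' (Neg q) \<in> x" if "x \<in> Ck f" for x
        unfolding s(4)[OF j' that] K_mem_iff[OF Ck_Omega[OF that]]
        using Neg_q[OF Ck_sim[OF that]] by simp
      then have "s y1 \<noteq> s y2" using y1(1) y2(1,3) q1 by metis
      moreover have "e \<in> s y1" "e \<in> s y2"
        using s(2)[OF y1(1) S_S0[OF S0(2)]] s(2)[OF y2(1) S_S0[OF S0(2)]] eN y1(2) y2N(1) by simp_all
      ultimately show thesis using that[OF s(1)[OF y1(1)] s(1)[OF y2(1)] _ _ s(3)] by simp
    qed
  qed
qed

end


section \<open>A Cantor scheme\<close>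

text \<open>The pairs are treated one after the other; further shrinking preserves the separations
  already achieved.\<close>

lemma separate_finitely_many:
  fixes U :: "'i \<Rightarrow> 'a set" and R :: "nat \<Rightarrow> 'a \<Rightarrow> 'a \<Rightarrow> bool"
  assumes sep: "\<And>n U V. U \<in> B \<Longrightarrow> V \<in> B \<Longrightarrow>
      \<exists>U'\<in>B. \<exists>V'\<in>B. U' \<subseteq> U \<and> V' \<subseteq> V \<and> (\<forall>x\<in>U'. \<forall>y\<in>V'. \<not> R n x y)"
    and "finite T" "\<And>i k n. (i, k, n) \<in> T \<Longrightarrow> i \<noteq> k" "\<And>i. U i \<in> B"
  shows "\<exists>U'. (\<forall>i. U' i \<in> B \<and> U' i \<subseteq> U i) \<and>
    (\<forall>i k n. (i, k, n) \<in> T \<longrightarrow> (\<forall>x\<in>U' i. \<forall>y\<in>U' k. \<not> R n x y))"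
  using assms(2,3)
proof (induction T)
  case empty
  then show ?case using assms(4) by (intro exI[of _ U]) simp
next
  case (insert p T)
  obtain a b m where p: "p = (a, b, m)" by (cases p) auto
  have "a \<noteq> b" using insert.prems[of a b m] p by simp
  obtain U1 where U1: "\<And>i. U1 i \<in> B" "\<And>i. U1 i \<subseteq> U i"
    "\<And>i k n x y. (i, k, n) \<in> T \<Longrightarrow> x \<in> U1 i \<Longrightarrow> y \<in> U1 k \<Longrightarrow> \<not> R n x y"
    using insert.IH insert.prems by (metis insertCI)
  obtain A A' where A: "A \<in> B" "A' \<in> B" "A \<subseteq> U1 a" "A' \<subseteq> U1 b" "\<forall>x\<in>A. \<forall>y\<in>A'. \<not> R m x y"
    using sep[OF U1(1) U1(1)] by metis
  define U2 where "U2 = U1(a := A, b := A')"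
  have U2: "U2 i \<in> B" "U2 i \<subseteq> U1 i" for i using A U1(1) by (auto simp: U2_def)
  have "\<not> R n x y" if "(i, k, n) \<in> insert p T" "x \<in> U2 i" "y \<in> U2 k" for i k n x y
  proof (cases "(i, k, n) \<in> T")
    case True
    then show ?thesis using U1(3) U2(2) that(2,3) by blast
  next
    case False
    then have "i = a" "k = b" "n = m" using that(1) p by auto
    then show ?thesis using that(2,3) A(5) \<open>a \<noteq> b\<close> by (simp add: U2_def)
  qed
  moreover have "U2 i \<subseteq> U i" for i using U2(2) U1(2) by (rule order_trans)
  ultimately show ?case using U2(1) by (intro exI[of _ U2]) simp
qed

text \<open>\<open>B\<close> plays the role of a base of non-empty open sets, \<open>D n\<close> of dense open sets and \<open>R n\<close> of closed
  relations with dense complement.\<close>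

lemma cantor_scheme:
  fixes B :: "'a set set" and D :: "nat \<Rightarrow> 'a set" and R :: "nat \<Rightarrow> 'a \<Rightarrow> 'a \<Rightarrow> bool"
  assumes B: "U0 \<in> B"
    and chain: "\<And>s :: nat \<Rightarrow> 'a set. (\<And>n. s n \<in> B) \<Longrightarrow> (\<And>n. s (Suc n) \<subseteq> s n) \<Longrightarrow> \<exists>x. \<forall>n. x \<in> s n"
    and dense: "\<And>n U. U \<in> B \<Longrightarrow> \<exists>V\<in>B. V \<subseteq> U \<inter> D n"
    and sep: "\<And>n U V. U \<in> B \<Longrightarrow> V \<in> B \<Longrightarrow>
      \<exists>U'\<in>B. \<exists>V'\<in>B. U' \<subseteq> U \<and> V' \<subseteq> V \<and> (\<forall>x\<in>U'. \<forall>y\<in>V'. \<not> R n x y)"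
  obtains \<phi> :: "(nat \<Rightarrow> bool) \<Rightarrow> 'a"
  where "\<And>\<alpha>. \<phi> \<alpha> \<in> U0" "\<And>\<alpha> n. \<phi> \<alpha> \<in> D n" "\<And>\<alpha> \<beta> n. \<alpha> \<noteq> \<beta> \<Longrightarrow> \<not> R n (\<phi> \<alpha>) (\<phi> \<beta>)"
proof -
  \<comment> \<open>\<open>W n s\<close> is total in \<open>s\<close>, though only words of length
    \<open>n\<close> matter; this saves side conditions on lengths.\<close>
  let ?P = "\<lambda>(n :: nat) W. (\<forall>s :: bool list. W s \<in> B) \<and> (n = 0 \<longrightarrow> W [] = U0)"
  let ?Q = "\<lambda>(n :: nat) W W'. (\<forall>s b. W' (s @ [b]) \<subseteq> W s) \<and> (\<forall>s. W' s \<subseteq> D n) \<and>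
    (\<forall>s t m. length s = Suc n \<longrightarrow> length t = Suc n \<longrightarrow> s \<noteq> t \<longrightarrow> m \<le> n \<longrightarrow>
      (\<forall>x\<in>W' s. \<forall>y\<in>W' t. \<not> R m x y))"
  have "\<exists>W. \<forall>n. ?P n (W n) \<and> ?Q n (W n) (W (Suc n))"
  proof (rule dependent_nat_choice)
    show "\<exists>W. ?P 0 W" using B by (intro exI[of _ "\<lambda>_. U0"]) simp
  next
    fix W :: "bool list \<Rightarrow> 'a set" and n :: nat
    assume W: "?P n W"
    obtain v where v: "\<And>U. U \<in> B \<Longrightarrow> v U \<in> B" "\<And>U. U \<in> B \<Longrightarrow> v U \<subseteq> U \<inter> D n"
      using dense[of _ n] by metis
    let ?L = "{s :: bool list. length s = Suc n}"
    \<comment> \<open>Only the relations up to index \<open>n\<close> are separated at level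
      \<open>n\<close>, which keeps \<open>?T\<close> finite; each relation is treated from its own
      index on.\<close>
    let ?T = "{(s, t, m). s \<in> ?L \<and> t \<in> ?L \<and> s \<noteq> t \<and> m \<le> n}"
    have "finite ?L" using finite_lists_length_eq[of "UNIV :: bool set" "Suc n"] by simp
    then have "finite (?L \<times> ?L \<times> {..n})" by simp
    then have T: "finite ?T" by (rule finite_subset[rotated]) auto
    have "\<exists>U'. (\<forall>s. U' s \<in> B \<and> U' s \<subseteq> v (W (butlast s))) \<and>
        (\<forall>s t m. (s, t, m) \<in> ?T \<longrightarrow> (\<forall>x\<in>U' s. \<forall>y\<in>U' t. \<not> R m x y))"
      by (rule separate_finitely_many[OF sep T]) (use W v(1) in auto)
    then obtain U' where U0': "(\<forall>s. U' s \<in> B \<and> U' s \<subseteq> v (W (butlast s))) \<and>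
        (\<forall>s t m. (s, t, m) \<in> ?T \<longrightarrow> (\<forall>x\<in>U' s. \<forall>y\<in>U' t. \<not> R m x y))" ..
    then have U': "\<And>s. U' s \<in> B" "\<And>s. U' s \<subseteq> v (W (butlast s))" by simp_all
    have sub: "U' s \<subseteq> W (butlast s) \<inter> D n" for s
      using U'(2)[of s] v(2)[of "W (butlast s)"] W by blast
    have "?Q n W U'"
    proof (intro conjI allI impI ballI)
      show "U' (s @ [b]) \<subseteq> W s" for s b
        using sub[of "s @ [b]"] by simp
      show "U' s \<subseteq> D n" for s using sub[of s] by simp
      show "\<not> R m x y"
        if "length s = Suc n" "length t = Suc n" "s \<noteq> t" "m \<le> n" "x \<in> U' s" "y \<in> U' t" for s t m x y
        using U0'[THEN conjunct2, rule_format, of s t m] that by simp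
    qed
    then show "\<exists>W'. ?P (Suc n) W' \<and> ?Q n W W'" using U'(1) by (intro exI[of _ U']) simp
  qed
  then obtain W where W0: "\<forall>n. ?P n (W n) \<and> ?Q n (W n) (W (Suc n))" ..
  have P: "?P n (W n)" and Q: "?Q n (W n) (W (Suc n))" for n using W0[THEN spec, of n] by simp_all
  have W: "W n s \<in> B" "W 0 [] = U0" "W (Suc n) (s @ [b]) \<subseteq> W n s" "W (Suc n) s \<subseteq> D n" for n s b
    using P[of n] P[of 0] Q[of n] by simp_all
  have sep_W: "\<not> R m x y" if "length s = Suc n" "length t = Suc n" "s \<noteq> t" "m \<le> n"
      "x \<in> W (Suc n) s" "y \<in> W (Suc n) t" for n s t m x y
    using Q[of n, THEN conjunct2, THEN conjunct2, rule_format, OF that] .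
  have "\<exists>x. \<forall>n. x \<in> W n (map \<alpha> [0..<n])" for \<alpha> :: "nat \<Rightarrow> bool"
    by (rule chain) (use W(1,3) in auto)
  then obtain \<phi> where \<phi>: "\<And>\<alpha> n. \<phi> \<alpha> \<in> W n (map \<alpha> [0..<n])" by metis
  show thesis
  proof
    show "\<phi> \<alpha> \<in> U0" for \<alpha> using \<phi>[of \<alpha> 0] W(2) by simp
    show "\<phi> \<alpha> \<in> D n" for \<alpha> n using \<phi>[of \<alpha> "Suc n"] W(4) by blast
    show "\<not> R n (\<phi> \<alpha>) (\<phi> \<beta>)" if neq: "\<alpha> \<noteq> \<beta>" for \<alpha> \<beta> n
    proof -
      obtain k where k: "\<alpha> k \<noteq> \<beta> k" using neq by (auto simp: fun_eq_iff)
      \<comment> \<open>From level \<open>n\<close> on the relation \<open>R n\<close> is handled,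
        and prefixes of length greater than \<open>k\<close> show the difference of the
        branches.\<close>
      let ?m = "max n k"
      have "map \<alpha> [0..<Suc ?m] ! k \<noteq> map \<beta> [0..<Suc ?m] ! k" using k by (simp del: upt_Suc)
      then have "map \<alpha> [0..<Suc ?m] \<noteq> map \<beta> [0..<Suc ?m]" by metis
      then show ?thesis using sep_W[OF _ _ _ _ \<phi>[of \<alpha> "Suc ?m"] \<phi>[of \<beta> "Suc ?m"]] by simp
    qed
  qed
qed

text \<open>The finite intersection property for the traces on \<open>Y\<close> of the basic clopen
  sets.\<close>

definition fm_compact :: "('x, 'j) fm set set \<Rightarrow> bool" where
  "fm_compact Y \<longleftrightarrow> Y \<subseteq> Omega \<and>
    (\<forall>T. (\<forall>S. finite S \<and> S \<subseteq> T \<longrightarrow> (\<exists>y\<in>Y. S \<subseteq> y)) \<longrightarrow> (\<exists>y\<in>Y. T \<subseteq> y))"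

definition fm_open :: "('x, 'j) fm set set \<Rightarrow> ('x, 'j) fm set set \<Rightarrow> bool" where
  "fm_open Y U \<longleftrightarrow> (\<forall>y\<in>Y. y \<in> U \<longrightarrow> (\<exists>h\<in>y. \<forall>x\<in>Y. h \<in> x \<longrightarrow> x \<in> U))"

definition fm_dense :: "('x, 'j) fm set set \<Rightarrow> ('x, 'j) fm set set \<Rightarrow> bool" where
  "fm_dense Y U \<longleftrightarrow> (\<forall>y\<in>Y. \<forall>g\<in>y. \<exists>x\<in>Y. g \<in> x \<and> x \<in> U)"

lemma fm_compactD: "fm_compact Y \<Longrightarrow> y \<in> Y \<Longrightarrow> y \<in> Omega"
  by (auto simp: fm_compact_def)

text \<open>The base consists of the non-empty traces of formulas on \<open>Y\<close>, with
  \<open>Conj\<close> for intersections. The last two hypotheses say that the complement of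
  \<open>R n\<close> is open and dense in the square of \<open>Y\<close>.\<close>

lemma cantor_scheme_fm:
  fixes Y :: "('x::countable, 'j::countable) fm set set"
    and D :: "nat \<Rightarrow> ('x, 'j) fm set set" and R :: "nat \<Rightarrow> _ \<Rightarrow> _ \<Rightarrow> bool"
  assumes Y: "fm_compact Y" "y0 \<in> Y"
    and D: "\<And>n. fm_open Y (D n)" "\<And>n. fm_dense Y (D n)"
    and closed: "\<And>n x x'. x \<in> Y \<Longrightarrow> x' \<in> Y \<Longrightarrow> \<not> R n x x' \<Longrightarrow>
      \<exists>h\<in>x. \<exists>h'\<in>x'. \<forall>u\<in>Y. \<forall>u'\<in>Y. h \<in> u \<longrightarrow> h' \<in> u' \<longrightarrow> \<not> R n u u'"
    and unrelated: "\<And>n y y' g g'. y \<in> Y \<Longrightarrow> y' \<in> Y \<Longrightarrow> g \<in> y \<Longrightarrow> g' \<in> y' \<Longrightarrow>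
      \<exists>z\<in>Y. \<exists>z'\<in>Y. g \<in> z \<and> g' \<in> z' \<and> \<not> R n z z'"
  obtains \<phi> :: "(nat \<Rightarrow> bool) \<Rightarrow> ('x, 'j) fm set"
  where "\<And>\<alpha>. \<phi> \<alpha> \<in> Y" "\<And>\<alpha> n. \<phi> \<alpha> \<in> D n" "\<And>\<alpha> \<beta> n. \<alpha> \<noteq> \<beta> \<Longrightarrow> \<not> R n (\<phi> \<alpha>) (\<phi> \<beta>)"
proof -
  define N where "N g = {y \<in> Y. g \<in> y}" for g
  define B where "B = {N g |g. N g \<noteq> {}}"
  have BI: "N g \<in> B" if "y \<in> N g" for y g using that unfolding B_def by blast
  have BE: "\<exists>g y. U = N g \<and> y \<in> N g" if "U \<in> B" for U using that unfolding B_def by blast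
  have N_Conj: "N (Conj g h) = N g \<inter> N h" for g h
    using Omega_Conj_iff fm_compactD[OF Y(1)] by (auto simp: N_def)
  obtain g0 where "g0 \<in> y0"
    using fm_compactD[OF Y] unfolding Omega_def complete_fms_def by blast
  then have B0: "N g0 \<in> B" using BI[of y0 g0] Y(2) by (simp add: N_def)
  have chain: "\<exists>x. \<forall>n. x \<in> s n" if s: "\<And>n. s n \<in> B" "\<And>n. s (Suc n) \<subseteq> s n" for s :: "nat \<Rightarrow> _"
  proof -
    obtain g y where g: "\<And>n. s n = N (g n)" and y: "\<And>n. y n \<in> N (g n)" using BE[OF s(1)] by metis
    have mono: "s n \<subseteq> s m" if "m \<le> n" for m n using lift_Suc_antimono_le[of s m n] s(2) that by blast
    have fin: "\<exists>y\<in>Y. S \<subseteq> y" if S: "finite S" "S \<subseteq> range g" for S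
    proof -
      obtain I where I: "finite I" "S = g ` I" using finite_subset_image[OF S] by blast
      obtain n where n: "\<And>i. i \<in> I \<Longrightarrow> i \<le> n" using I(1) by (meson finite_nat_set_iff_bounded_le)
      have "y n \<in> s i" if "i \<in> I" for i using mono[OF n[OF that]] y[of n] g by blast
      then have "y n \<in> N (g i)" if "i \<in> I" for i using that g by simp
      then have "S \<subseteq> y n" using I(2) by (auto simp: N_def)
      then show ?thesis using y[of n] by (auto simp: N_def)
    qed
    then obtain x where "x \<in> Y" "range g \<subseteq> x" using Y(1) unfolding fm_compact_def by meson
    then have "x \<in> s n" for n using g by (auto simp: N_def)
    then show ?thesis by blast
  qed
  have dense: "\<exists>V\<in>B. V \<subseteq> U \<inter> D n" if U: "U \<in> B" for n U
  proof -
    obtain g y where g: "U = N g" "y \<in> N g" using BE[OF U] by blast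
    then have y: "y \<in> Y" "g \<in> y" by (simp_all add: N_def)
    obtain x where x: "x \<in> Y" "g \<in> x" "x \<in> D n" using D(2)[of n] y unfolding fm_dense_def by blast
    then obtain h where h: "h \<in> x" "\<forall>u\<in>Y. h \<in> u \<longrightarrow> u \<in> D n" using D(1)[of n] unfolding fm_open_def by blast
    have "x \<in> N (Conj g h)" using x h(1) unfolding N_Conj by (simp add: N_def)
    then have "N (Conj g h) \<in> B" by (rule BI)
    moreover have "N (Conj g h) \<subseteq> U \<inter> D n" using h(2) g(1) unfolding N_Conj by (auto simp: N_def)
    ultimately show ?thesis by blast
  qed
  have sep: "\<exists>U'\<in>B. \<exists>V'\<in>B. U' \<subseteq> U \<and> V' \<subseteq> V \<and> (\<forall>x\<in>U'. \<forall>y\<in>V'. \<not> R n x y)"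
    if U: "U \<in> B" and V: "V \<in> B" for n U V
  proof -
    obtain g y where g: "U = N g" "y \<in> N g" using BE[OF U] by blast
    obtain g' y' where g': "V = N g'" "y' \<in> N g'" using BE[OF V] by blast
    obtain z z' where z: "z \<in> Y" "z' \<in> Y" "g \<in> z" "g' \<in> z'" "\<not> R n z z'"
      using unrelated[of y y' g g' n] g(2) g'(2) unfolding N_def by blast
    obtain h h' where h: "h \<in> z" "h' \<in> z'" "\<forall>u\<in>Y. \<forall>u'\<in>Y. h \<in> u \<longrightarrow> h' \<in> u' \<longrightarrow> \<not> R n u u'"
      using closed[OF z(1,2,5)] by blast
    have "z \<in> N (Conj g h)" "z' \<in> N (Conj g' h')" using z h(1,2) unfolding N_Conj by (simp_all add: N_def)
    then have "N (Conj g h) \<in> B" "N (Conj g' h') \<in> B" using BI by simp_all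
    moreover have "N (Conj g h) \<subseteq> U" "N (Conj g' h') \<subseteq> V" using g(1) g'(1) unfolding N_Conj by simp_all
    moreover have "\<forall>x\<in>N (Conj g h). \<forall>y\<in>N (Conj g' h'). \<not> R n x y"
      using h(3) unfolding N_Conj by (simp add: N_def)
    ultimately show ?thesis by blast
  qed
  show thesis
  proof (rule cantor_scheme[of "N g0" B D R, OF B0 chain dense sep])
    fix \<phi> :: "(nat \<Rightarrow> bool) \<Rightarrow> ('x, 'j) fm set"
    assume "\<And>\<alpha>. \<phi> \<alpha> \<in> N g0" "\<And>\<alpha> n. \<phi> \<alpha> \<in> D n" "\<And>\<alpha> \<beta> n. \<alpha> \<noteq> \<beta> \<Longrightarrow> \<not> R n (\<phi> \<alpha>) (\<phi> \<beta>)"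
    then show thesis using that[of \<phi>] by (simp add: N_def)
  qed
qed

text \<open>The Baire theorem is the case of empty relations, applied to the clopen part of
  \<open>Y\<close> where \<open>g\<close> holds; a single branch is used.\<close>

lemma Baire_fm:
  fixes Y :: "('x::countable, 'j::countable) fm set set"
  assumes Y: "fm_compact Y" and D: "\<And>n :: nat. fm_open Y (D n)" "\<And>n. fm_dense Y (D n)"
    and "y \<in> Y" "g \<in> y"
  obtains x where "x \<in> Y" "g \<in> x" "\<And>n. x \<in> D n"
proof -
  let ?Y = "{x \<in> Y. g \<in> x}"
  have "\<exists>x\<in>?Y. T \<subseteq> x" if T: "\<forall>S. finite S \<and> S \<subseteq> T \<longrightarrow> (\<exists>x\<in>?Y. S \<subseteq> x)" for T
  proof -
    have "\<exists>x\<in>Y. S \<subseteq> x" if S: "finite S" "S \<subseteq> insert g T" for S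
    proof -
      have "finite (S - {g})" "S - {g} \<subseteq> T" using S by auto
      then obtain x where "x \<in> ?Y" "S - {g} \<subseteq> x" using T by metis
      then show ?thesis by blast
    qed
    then obtain x where "x \<in> Y" "insert g T \<subseteq> x" using Y unfolding fm_compact_def by metis
    then show ?thesis by auto
  qed
  then have Y': "fm_compact ?Y" using Y unfolding fm_compact_def by auto
  have op: "fm_open ?Y (D n)" for n using D(1)[of n] unfolding fm_open_def by blast
  have de: "fm_dense ?Y (D n)" for n
    unfolding fm_dense_def
  proof (intro ballI)
    fix x h assume x: "x \<in> ?Y" "h \<in> x"
    then have "Conj g h \<in> x" using Omega_Conj_iff fm_compactD[OF Y] by auto
    then obtain u where u: "u \<in> Y" "Conj g h \<in> u" "u \<in> D n"
      using D(2)[of n] x(1) unfolding fm_dense_def by blast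
    then show "\<exists>u\<in>?Y. h \<in> u \<and> u \<in> D n" using Omega_Conj_iff[OF fm_compactD[OF Y u(1)], of g h] by auto
  qed
  have y: "y \<in> ?Y" using assms(4,5) by simp
  show thesis
  proof (rule cantor_scheme_fm[OF Y' y op de, of "\<lambda>_ _ _. False"])
    fix \<phi> :: "(nat \<Rightarrow> bool) \<Rightarrow> ('x, 'j) fm set"
    assume "\<And>\<alpha>. \<phi> \<alpha> \<in> ?Y" "\<And>\<alpha> n. \<phi> \<alpha> \<in> D n"
    then show thesis using that[of "\<phi> undefined"] by simp
  qed (use fm_compactD[OF Y] Omega_def complete_fms_def in blast)+
qed


section \<open>Generic points\<close>

lemma Omega_distinguish:
  fixes z :: "('x::countable, 'j::countable) fm set"
  assumes "z \<in> Omega" "z' \<in> Omega" "z \<noteq> z'"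
  obtains g where "g \<in> z" "g \<notin> z'"
proof -
  have "\<not> z \<subseteq> z'"
  proof
    assume "z \<subseteq> z'"
    moreover have "g \<in> z" if "g \<in> z'" for g
      using that \<open>z \<subseteq> z'\<close> Omega_Neg_iff[OF assms(1), of g] Omega_Neg_iff[OF assms(2), of g] by blast
    ultimately show False using assms(3) by blast
  qed
  then show thesis using that by blast
qed

lemma fm_compact_possibility_set:
  fixes z :: "('x::countable, 'j::countable) fm set"
  assumes "z \<in> Omega"
  shows "fm_compact {y. sim j z y}"
  unfolding fm_compact_def
proof (intro conjI allI impI)
  show "{y. sim j z y} \<subseteq> Omega" using sim_Omega(2) by auto
  fix T assume T: "\<forall>S. finite S \<and> S \<subseteq> T \<longrightarrow> (\<exists>y\<in>{y. sim j z y}. S \<subseteq> y)"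
  have "\<exists>y. sim j z y \<and> S \<subseteq> y" if "finite S" "S \<subseteq> T" for S
    using T[rule_format, OF conjI, OF that] by simp
  then show "\<exists>y\<in>{y. sim j z y}. T \<subseteq> y" using sim_compact[OF _ assms] by (metis mem_Collect_eq)
qed

lemma fm_compact_Ck: "fm_compact (Ck f)" for f :: "('x::countable, 'j::finite) fm"
  unfolding fm_compact_def
proof (intro conjI allI impI)
  show "Ck f \<subseteq> Omega" using Ck_Omega by (rule subsetI)
  fix T assume T: "\<forall>S. finite S \<and> S \<subseteq> T \<longrightarrow> (\<exists>y\<in>Ck f. S \<subseteq> y)"
  let ?F = "range (\<lambda>n. (E ^^ n) f)"
  have fin: "\<exists>z\<in>Omega. S \<subseteq> z" if S: "finite S" "S \<subseteq> T \<union> ?F" for S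
  proof -
    have "finite (S \<inter> T)" "S \<inter> T \<subseteq> T" using S(1) by auto
    from T[rule_format, OF conjI, OF this]
    obtain y where y: "y \<in> Ck f" "S \<inter> T \<subseteq> y" by (rule bexE)
    then have "?F \<subseteq> y" by (auto simp: Ck_def)
    then have "S \<subseteq> y" using S(2) y(2) by blast
    then show ?thesis using Ck_Omega[OF y(1)] by (rule bexI)
  qed
  obtain z where z: "z \<in> Omega" "T \<union> ?F \<subseteq> z" by (rule Omega_compact[OF fin])
  then have "z \<in> Ck f" by (auto simp: Ck_def)
  then show "\<exists>y\<in>Ck f. T \<subseteq> y" using z(2) by (intro bexI[of _ z]) simp_all
qed

text \<open>Required for all \<open>g\<close>, this says that the possibility set of
  \<open>z\<close> for \<open>j\<close> has no isolated point.\<close>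

definition splits :: "'j \<Rightarrow> ('x, 'j) fm \<Rightarrow> ('x, 'j) fm set set" where
  "splits j g = {z. (\<exists>y. sim j z y \<and> g \<in> y) \<longrightarrow>
     (\<exists>y y'. sim j z y \<and> sim j z y' \<and> g \<in> y \<and> g \<in> y' \<and> y \<noteq> y')}"

definition meets_in :: "'j \<Rightarrow> ('x, 'j) fm \<Rightarrow> ('x, 'j) fm set set \<Rightarrow> ('x, 'j) fm set set" where
  "meets_in j g U = {z. (\<exists>y. sim j z y \<and> g \<in> y) \<longrightarrow> (\<exists>y. sim j z y \<and> g \<in> y \<and> y \<in> U)}"

text \<open>The iterations of \<open>meets_in\<close> make generic points dense in the possibility sets of a generic point.\<close>

definition generic_cond :: "('j \<times> ('x, 'j) fm) list \<Rightarrow> 'j \<Rightarrow> ('x, 'j) fm \<Rightarrow> ('x, 'j) fm set set" where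
  "generic_cond w j g = foldr (\<lambda>(i, h). meets_in i h) w (splits j g)"

definition generic :: "('x, 'j) fm set \<Rightarrow> bool" where
  "generic z \<longleftrightarrow> (\<forall>w j g. z \<in> generic_cond w j g)"

context several_dense_cells
begin

lemma Ck_path: "agent_path w z z' \<Longrightarrow> z \<in> Ck f \<Longrightarrow> z' \<in> Ck f"
proof (induction w arbitrary: z)
  case (Cons j w)
  then obtain y where y: "sim j z y" "agent_path w y z'" by auto
  show ?case by (rule Cons.IH[OF y(2) Ck_sim[OF Cons.prems(2) y(1)]])
qed simp

text \<open>Density has to produce a point satisfying \<open>h\<close> near \<open>z\<close>, while
  the construction happens at a point \<open>y\<close> satisfying \<open>g\<close>. The formula
  \<open>Conj g (M j h)\<close> at \<open>y\<close> remembers that some point of the same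
  possibility set satisfies \<open>h\<close>.\<close>

lemma Conj_M_mem:
  fixes z y :: "('x, 'j) fm set"
  shows "sim j z y \<Longrightarrow> g \<in> y \<Longrightarrow> h \<in> z \<Longrightarrow> Conj g (M j h) \<in> y"
  using Omega_Conj_iff[OF sim_Omega(2), of j z y] M_mem_iff[OF sim_Omega(2), of j z y j h] sim_sym[of j z y]
  by blast

lemma Conj_M_D:
  fixes y :: "('x, 'j) fm set"
  assumes "Conj g (M j h) \<in> y" "y \<in> Omega"
  obtains z where "g \<in> y" "sim j z y" "h \<in> z"
proof -
  have "g \<in> y" "M j h \<in> y" using assms(1) Omega_Conj_iff[OF assms(2)] by simp_all
  then obtain z where "sim j y z" "h \<in> z" using M_mem_iff[OF assms(2)] by blast
  then show thesis using that[OF \<open>g \<in> y\<close> sim_sym] by blast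
qed

lemma splits_open: "fm_open (Ck f) (splits j g)"
  unfolding fm_open_def
proof (intro ballI impI)
  fix z assume z: "z \<in> Ck f" "z \<in> splits j g"
  have zO: "z \<in> Omega" using Ck_Omega[OF z(1)] .
  show "\<exists>h\<in>z. \<forall>x\<in>Ck f. h \<in> x \<longrightarrow> x \<in> splits j g"
  proof (cases "\<exists>y. sim j z y \<and> g \<in> y")
    case False
    have "Neg (M j g) \<in> z"
      using False M_mem_iff[OF zO, of j g] Omega_Neg_iff[OF zO, of "M j g"] by simp
    moreover have "x \<in> splits j g" if "x \<in> Ck f" "Neg (M j g) \<in> x" for x
      using that(2) M_mem_iff[OF Ck_Omega[OF that(1)], of j g] Omega_Neg_iff[OF Ck_Omega[OF that(1)], of "M j g"]
      unfolding splits_def by auto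
    ultimately show ?thesis by blast
  next
    case True
    then obtain y y' where y: "sim j z y" "sim j z y'" "g \<in> y" "g \<in> y'" "y \<noteq> y'"
      using z(2) unfolding splits_def by blast
    have yO: "y \<in> Omega" "y' \<in> Omega" using sim_Omega(2)[OF y(1)] sim_Omega(2)[OF y(2)] by simp_all
    obtain e where e: "e \<in> y" "e \<notin> y'" using Omega_distinguish[OF yO y(5)] by blast
    have "Conj g e \<in> y" "Conj g (Neg e) \<in> y'" using y e yO by (simp_all add: Omega_simps)
    then have "M j (Conj g e) \<in> z" "M j (Conj g (Neg e)) \<in> z"
      using M_mem_iff[OF zO, of j] y(1,2) by metis+
    \<comment> \<open>Two points of the possibility set that differ on \<open>e\<close> remain
      available at every point satisfying this formula.\<close>
    then have "Conj (M j (Conj g e)) (M j (Conj g (Neg e))) \<in> z" by (simp add: Omega_Conj_iff[OF zO])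
    moreover have "x \<in> splits j g"
      if x: "x \<in> Ck f" "Conj (M j (Conj g e)) (M j (Conj g (Neg e))) \<in> x" for x
    proof -
      have xO: "x \<in> Omega" using Ck_Omega[OF x(1)] .
      have "M j (Conj g e) \<in> x" "M j (Conj g (Neg e)) \<in> x" using x(2) by (simp_all add: Omega_Conj_iff[OF xO])
      then obtain u u' where u: "sim j x u" "sim j x u'" "Conj g e \<in> u" "Conj g (Neg e) \<in> u'"
        using M_mem_iff[OF xO, of j] by metis
      have "g \<in> u" "g \<in> u'" "e \<in> u" "e \<notin> u'"
        using u(3,4) sim_Omega(2)[OF u(1)] sim_Omega(2)[OF u(2)] by (simp_all add: Omega_simps)
      then show ?thesis using u(1,2) unfolding splits_def by blast
    qed
    ultimately show ?thesis by blast
  qed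
qed

lemma splits_dense: "fm_dense (Ck f) (splits j g)"
  unfolding fm_dense_def
proof (intro ballI)
  fix z h assume z: "z \<in> Ck f" "h \<in> z"
  show "\<exists>x\<in>Ck f. h \<in> x \<and> x \<in> splits j g"
  proof (cases "z \<in> splits j g")
    case False
    then obtain y where y: "sim j z y" "g \<in> y" unfolding splits_def by blast
    obtain z1 z2 where zz: "z1 \<in> Ck f" "z2 \<in> Ck f" "Conj g (M j h) \<in> z1" "Conj g (M j h) \<in> z2"
        "sim j z1 z2" "z1 \<noteq> z2"
      using split_possibility_set[OF Ck_sim[OF z(1) y(1)] Conj_M_mem[OF y z(2)]] by blast
    obtain x where x: "g \<in> z1" "sim j x z1" "h \<in> x" using Conj_M_D[OF zz(3) Ck_Omega[OF zz(1)]] by blast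
    have "g \<in> z2" using zz(4) Omega_Conj_iff[OF Ck_Omega[OF zz(2)]] by blast
    then have "x \<in> splits j g"
      using x zz(6) sim_trans[OF x(2) zz(5)] unfolding splits_def by blast
    then show ?thesis using Ck_sim[OF zz(1) sim_sym[OF x(2)]] x(3) by blast
  qed (use z in blast)
qed

lemma meets_in_open:
  assumes "fm_open (Ck f) U"
  shows "fm_open (Ck f) (meets_in j g U)"
  unfolding fm_open_def
proof (intro ballI impI)
  fix z assume z: "z \<in> Ck f" "z \<in> meets_in j g U"
  have zO: "z \<in> Omega" using Ck_Omega[OF z(1)] .
  show "\<exists>h\<in>z. \<forall>x\<in>Ck f. h \<in> x \<longrightarrow> x \<in> meets_in j g U"
  proof (cases "\<exists>y. sim j z y \<and> g \<in> y")
    case False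
    have "Neg (M j g) \<in> z"
      using False M_mem_iff[OF zO, of j g] Omega_Neg_iff[OF zO, of "M j g"] by simp
    moreover have "x \<in> meets_in j g U" if "x \<in> Ck f" "Neg (M j g) \<in> x" for x
      using that(2) M_mem_iff[OF Ck_Omega[OF that(1)], of j g] Omega_Neg_iff[OF Ck_Omega[OF that(1)], of "M j g"]
      unfolding meets_in_def by auto
    ultimately show ?thesis by blast
  next
    case True
    then obtain y where y: "sim j z y" "g \<in> y" "y \<in> U" using z(2) unfolding meets_in_def by blast
    obtain k where k: "k \<in> y" "\<forall>x\<in>Ck f. k \<in> x \<longrightarrow> x \<in> U"
      using assms Ck_sim[OF z(1) y(1)] y(3) unfolding fm_open_def by blast
    have "Conj g k \<in> y" using y(2) k(1) Omega_Conj_iff[OF sim_Omega(2)[OF y(1)]] by blast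
    then have "M j (Conj g k) \<in> z" using M_mem_iff[OF zO, of j "Conj g k"] y(1) by metis
    moreover have "x \<in> meets_in j g U" if x: "x \<in> Ck f" "M j (Conj g k) \<in> x" for x
    proof -
      obtain u where u: "sim j x u" "Conj g k \<in> u" using M_mem_iff[OF Ck_Omega[OF x(1)], of j "Conj g k"] x(2) by metis
      then have "g \<in> u" "k \<in> u" using Omega_Conj_iff[OF sim_Omega(2)[OF u(1)]] by blast+
      then show ?thesis using k(2) Ck_sim[OF x(1) u(1)] u(1) unfolding meets_in_def by blast
    qed
    ultimately show ?thesis by blast
  qed
qed

lemma meets_in_dense:
  assumes "fm_dense (Ck f) U"
  shows "fm_dense (Ck f) (meets_in j g U)"
  unfolding fm_dense_def
proof (intro ballI)
  fix z h assume z: "z \<in> Ck f" "h \<in> z"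
  show "\<exists>x\<in>Ck f. h \<in> x \<and> x \<in> meets_in j g U"
  proof (cases "z \<in> meets_in j g U")
    case False
    then obtain y where y: "sim j z y" "g \<in> y" unfolding meets_in_def by blast
    obtain u where u: "u \<in> Ck f" "Conj g (M j h) \<in> u" "u \<in> U"
      using assms Ck_sim[OF z(1) y(1)] Conj_M_mem[OF y z(2)] unfolding fm_dense_def by blast
    obtain x where x: "g \<in> u" "sim j x u" "h \<in> x" using Conj_M_D[OF u(2) Ck_Omega[OF u(1)]] by blast
    have "x \<in> meets_in j g U" using x(1,2) u(3) unfolding meets_in_def by blast
    then show ?thesis using Ck_sim[OF u(1) sim_sym[OF x(2)]] x(3) by blast
  qed (use z in blast)
qed

lemma generic_cond_open_dense: "fm_open (Ck f) (generic_cond w j g) \<and> fm_dense (Ck f) (generic_cond w j g)"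
proof (induction w)
  case Nil
  show ?case using splits_open splits_dense by (simp add: generic_cond_def)
next
  case (Cons p w)
  obtain i h where "p = (i, h)" by (cases p)
  then have "generic_cond (p # w) j g = meets_in i h (generic_cond w j g)" by (simp add: generic_cond_def)
  then show ?case using Cons meets_in_open meets_in_dense by simp
qed

text \<open>Baire's theorem inside the possibility set of \<open>z\<close>: density there of the
  condition for \<open>w\<close> is part of what the longer words \<open>(j, k) # w\<close> demand
  of \<open>z\<close>.\<close>

lemma generic_neighbour:
  assumes z: "z \<in> Ck f" "generic z" and y: "sim j z y" "g \<in> y"
  obtains y' where "sim j z y'" "g \<in> y'" "generic y'"
proof -
  let ?Y = "{y. sim j z y}"
  let ?D = "\<lambda>n. (case from_nat n of (w, i, h) \<Rightarrow> generic_cond w i h) :: ('x, 'j) fm set set"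
  have sub: "x \<in> Ck f" if "x \<in> ?Y" for x using Ck_sim[OF z(1)] that by simp
  have "fm_open ?Y (generic_cond w i h)" for w i h
    using generic_cond_open_dense[of w i h] sub unfolding fm_open_def by blast
  then have op: "fm_open ?Y (?D n)" for n by (simp split: prod.split)
  have "fm_dense ?Y (generic_cond w i h)" for w i h
    unfolding fm_dense_def
  proof (intro ballI)
    fix u k assume "u \<in> ?Y" "k \<in> u"
    moreover have "z \<in> generic_cond ((j, k) # w) i h" using z(2) unfolding generic_def by blast
    then have "z \<in> meets_in j k (generic_cond w i h)" by (simp add: generic_cond_def)
    ultimately show "\<exists>x\<in>?Y. k \<in> x \<and> x \<in> generic_cond w i h" unfolding meets_in_def by blast
  qed
  then have de: "fm_dense ?Y (?D n)" for n by (simp split: prod.split)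
  have yY: "y \<in> ?Y" using y(1) by simp
  show thesis
  proof (rule Baire_fm[OF fm_compact_possibility_set[OF Ck_Omega[OF z(1)]] op de yY y(2)])
    fix x assume x: "x \<in> ?Y" "g \<in> x" "\<And>n. x \<in> ?D n"
    have "x \<in> generic_cond w i h" for w i h using x(3)[of "to_nat (w, i, h)"] by simp
    then have "generic x" by (simp add: generic_def)
    then show thesis using that x(1,2) by simp
  qed
qed

text \<open>The end point \<open>z'\<close> cannot be kept, only the formula \<open>g\<close>.
  Before each step the remaining path is encoded by a dual of iterated \<open>K\<close>, which the
  generic neighbour inherits.\<close>

lemma generic_walk:
  assumes "agent_path w z z'" "z \<in> Ck f" "generic z" "g \<in> z'"
  obtains w' y where "agent_path w' z y" "g \<in> y" "generic y" "y \<in> Ck f"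
proof -
  have "\<exists>w' y. agent_path w' z y \<and> g \<in> y \<and> generic y \<and> y \<in> Ck f"
    using assms
  proof (induction w arbitrary: z z')
    case Nil
    then show ?case by (intro exI[of _ "[]"] exI[of _ z]) auto
  next
    case (Cons j w)
    then obtain y where y: "sim j z y" "agent_path w y z'" by auto
    have yO: "y \<in> Omega" using sim_Omega(2)[OF y(1)] .
    let ?h = "Neg (foldr K w (Neg g))"
    have "?h \<in> y"
      using y(2) Cons.prems(4) foldr_K_mem_iff[OF yO, of w "Neg g"] Omega_Neg_iff[OF yO]
        Omega_Neg_iff[of z' g] agent_path_Omega[OF y(2)] by blast
    then obtain u where u: "sim j z u" "?h \<in> u" "generic u"
      using generic_neighbour[OF Cons.prems(2,3) y(1)] by blast
    have uO: "u \<in> Omega" using sim_Omega(2)[OF u(1)] .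
    obtain x where x: "agent_path w u x" "Neg g \<notin> x"
      using u(2) foldr_K_mem_iff[OF uO, of w "Neg g"] Omega_Neg_iff[OF uO] by blast
    have "g \<in> x" using x(2) Omega_Neg_iff[of x g] agent_path_Omega[OF x(1)] by blast
    then obtain w' v where v: "agent_path w' u v" "g \<in> v" "generic v" "v \<in> Ck f"
      using Cons.IH[OF x(1) Ck_sim[OF Cons.prems(2) u(1)] u(3)] by blast
    then have "agent_path (j # w') z v" using u(1) by auto
    then show ?case using v(2-4) by blast
  qed
  then show thesis using that by blast
qed

end


section \<open>Counting\<close>

lemma nat_bool_eqpoll_reals: "(UNIV :: (nat \<Rightarrow> bool) set) \<approx> (UNIV :: real set)"
proof -
  have "bij_betw Collect (UNIV :: (nat \<Rightarrow> bool) set) (UNIV :: nat set set)"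
    by (rule bij_betw_byWitness[where f' = "\<lambda>A n. n \<in> A"]) auto
  then have "(UNIV :: (nat \<Rightarrow> bool) set) \<approx> (UNIV :: nat set set)" unfolding eqpoll_def by blast
  then show ?thesis using nat_sets_eqpoll_reals eqpoll_trans by blast
qed

lemma fm_sets_lepoll_reals: "(A :: ('x::countable, 'j::countable) fm set set) \<lesssim> (UNIV :: real set)"
proof -
  have "inj_on (image to_nat) A" by (rule inj_onI) (simp add: inj_image_eq_iff[OF inj_to_nat])
  then have "A \<lesssim> (UNIV :: nat set set)" unfolding lepoll_def by blast
  then show ?thesis using nat_sets_eqpoll_reals eqpoll_imp_lepoll lepoll_trans by blast
qed

lemma eqpoll_realsI:
  fixes \<phi> :: "(nat \<Rightarrow> bool) \<Rightarrow> 'a"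
  assumes "\<And>\<alpha>. \<phi> \<alpha> \<in> A" "\<And>\<alpha> \<beta>. \<alpha> \<noteq> \<beta> \<Longrightarrow> \<phi> \<alpha> \<noteq> \<phi> \<beta>" "A \<lesssim> (UNIV :: real set)"
  shows "A \<approx> (UNIV :: real set)"
proof -
  have "inj_on \<phi> UNIV" using assms(2) by (auto simp: inj_on_def)
  then have "(UNIV :: (nat \<Rightarrow> bool) set) \<lesssim> A"
    using assms(1) unfolding lepoll_def by (intro exI[of _ \<phi>]) auto
  then have "(UNIV :: real set) \<lesssim> A"
    using nat_bool_eqpoll_reals eqpoll_sym eqpoll_imp_lepoll lepoll_trans by blast
  then show ?thesis by (intro lepoll_antisym assms(3))
qed

text \<open>For all \<open>g\<close> together: the component of \<open>z\<close> meets every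
  non-empty basic open set of \<open>Ck f\<close>.\<close>

definition meets_component :: "('x, 'j::finite) fm \<Rightarrow> ('x, 'j) fm \<Rightarrow> ('x, 'j) fm set set" where
  "meets_component f g = {z. (\<exists>y\<in>Ck f. g \<in> y) \<longrightarrow> (\<exists>y\<in>component z. g \<in> y)}"

context several_dense_cells
begin

lemma meets_component_open: "fm_open (Ck f) (meets_component f g)"
  unfolding fm_open_def
proof (intro ballI impI)
  fix z assume z: "z \<in> Ck f" "z \<in> meets_component f g"
  have zO: "z \<in> Omega" using Ck_Omega[OF z(1)] .
  show "\<exists>h\<in>z. \<forall>x\<in>Ck f. h \<in> x \<longrightarrow> x \<in> meets_component f g"
  proof (cases "\<exists>y\<in>Ck f. g \<in> y")
    case False
    then have "\<forall>x. x \<in> meets_component f g" by (auto simp: meets_component_def)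
    moreover obtain h where "h \<in> z" using zO unfolding Omega_def complete_fms_def by blast
    ultimately show ?thesis by blast
  next
    case True
    then obtain y w where y: "agent_path w z y" "g \<in> y"
      using z(2) by (auto simp: meets_component_def component_def)
    let ?h = "Neg (foldr K w (Neg g))"
    have h: "?h \<in> x \<longleftrightarrow> (\<exists>y. agent_path w x y \<and> g \<in> y)" if "x \<in> Omega" for x
    proof -
      have "?h \<in> x \<longleftrightarrow> (\<exists>y. agent_path w x y \<and> Neg g \<notin> y)"
        using foldr_K_mem_iff[OF that, of w "Neg g"] Omega_Neg_iff[OF that] by simp
      also have "\<dots> \<longleftrightarrow> (\<exists>y. agent_path w x y \<and> g \<in> y)"
        using Omega_Neg_iff agent_path_Omega[of w x] by meson
      finally show ?thesis .
    qed
    have "?h \<in> z" using h[OF zO] y by blast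
    moreover have "x \<in> meets_component f g" if x: "x \<in> Ck f" "?h \<in> x" for x
      using h[OF Ck_Omega[OF x(1)]] x(2) unfolding meets_component_def component_def by blast
    ultimately show ?thesis by blast
  qed
qed

lemma meets_component_dense: "fm_dense (Ck f) (meets_component f g)"
  unfolding fm_dense_def
proof (intro ballI)
  fix z h assume "z \<in> Ck f" "h \<in> z"
  then obtain x where x: "x \<in> C1" "h \<in> x" using dense_meets(1) by blast
  have "C1 = component x" using cell_eq_component[OF cells(1) x(1)] .
  then have "x \<in> meets_component f g"
    using dense_meets(1) unfolding meets_component_def by auto
  then show "\<exists>x\<in>Ck f. h \<in> x \<and> x \<in> meets_component f g" using x cells_Ck(1) by blast
qed

text \<open>A perfect compact set contains a Cantor set: the scheme is run with equality as the
  relation to be avoided.\<close>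

lemma generic_possibility_set_continuum:
  assumes z: "z \<in> Ck f" "generic z"
  shows "{y. sim j z y} \<approx> (UNIV :: real set)"
proof -
  let ?Y = "{y. sim j z y}"
  have zO: "z \<in> Omega" using Ck_Omega[OF z(1)] .
  have YO: "y \<in> Omega" if "y \<in> ?Y" for y using sim_Omega(2) that by simp
  have zY: "z \<in> ?Y" using sim_refl[OF zO] by simp
  have op: "fm_open ?Y UNIV"
    using YO unfolding fm_open_def Omega_def complete_fms_def by blast
  have de: "fm_dense ?Y UNIV" unfolding fm_dense_def by blast
  have closed: "\<exists>h\<in>x. \<exists>h'\<in>x'. \<forall>u\<in>?Y. \<forall>u'\<in>?Y. h \<in> u \<longrightarrow> h' \<in> u' \<longrightarrow> u \<noteq> u'"
    if x: "x \<in> ?Y" "x' \<in> ?Y" "x \<noteq> x'" for x x'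
  proof -
    obtain e where e: "e \<in> x" "e \<notin> x'" using Omega_distinguish[OF YO[OF x(1)] YO[OF x(2)] x(3)] by blast
    have "Neg e \<in> x'" using e(2) Omega_Neg_iff[OF YO[OF x(2)]] by blast
    moreover have "u \<noteq> u'" if "u \<in> ?Y" "e \<in> u" "Neg e \<in> u'" for u u'
      using that(2,3) Omega_Neg_iff[OF YO[OF that(1)], of e] by auto
    ultimately show ?thesis using e(1) by blast
  qed
  have unrelated: "\<exists>u\<in>?Y. \<exists>u'\<in>?Y. g \<in> u \<and> g' \<in> u' \<and> u \<noteq> u'"
    if y: "y \<in> ?Y" "y' \<in> ?Y" "g \<in> y" "g' \<in> y'" for y y' g g'
  proof (cases "y = y'")
    case True
    have "Conj g g' \<in> y" using y True Omega_Conj_iff[OF YO[OF y(1)]] by blast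
    moreover have "z \<in> generic_cond [] j (Conj g g')" using z(2) unfolding generic_def by blast
    then have "z \<in> splits j (Conj g g')" by (simp add: generic_cond_def)
    ultimately obtain u u' where u: "sim j z u" "sim j z u'" "Conj g g' \<in> u" "Conj g g' \<in> u'" "u \<noteq> u'"
      using y(1) unfolding splits_def by blast
    then have "g \<in> u" "g' \<in> u'" "u \<in> ?Y" "u' \<in> ?Y"
      using Omega_Conj_iff[OF sim_Omega(2)[OF u(1)]] Omega_Conj_iff[OF sim_Omega(2)[OF u(2)]] by simp_all
    then show ?thesis using u(5) by blast
  qed (use y in blast)
  show ?thesis
  proof (rule cantor_scheme_fm[where D = "\<lambda>_. UNIV" and R = "\<lambda>_. (=)",
        OF fm_compact_possibility_set[OF zO] zY op de closed unrelated])
    fix \<phi> :: "(nat \<Rightarrow> bool) \<Rightarrow> ('x, 'j) fm set"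
    assume "\<And>\<alpha>. \<phi> \<alpha> \<in> ?Y" "\<And>\<alpha> \<beta> n. \<alpha> \<noteq> \<beta> \<Longrightarrow> \<not> \<phi> \<alpha> = \<phi> \<beta>"
    then show ?thesis by (intro eqpoll_realsI[of \<phi>] fm_sets_lepoll_reals) auto
  qed
qed

lemma generic_component:
  assumes z: "z \<in> Ck f" "generic z" and meets: "\<And>g. z \<in> meets_component f g"
  shows "cell (component z)" "dense_in_Ck (component z) f"
    "infinite {P. possibility_set P \<and> P \<subseteq> component z \<and> P \<approx> (UNIV :: real set)}" (is "infinite ?PP")
proof -
  have zO: "z \<in> Omega" using Ck_Omega[OF z(1)] .
  show cell: "cell (component z)" using zO unfolding cell_iff_component by blast
  have sub: "component z \<subseteq> Ck f" using Ck_path[OF _ z(1)] unfolding component_def by blast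
  have meets': "\<exists>y\<in>component z. g \<in> y" if "x \<in> Ck f" "g \<in> x" for x g
    using meets[of g] that unfolding meets_component_def by blast
  then show "dense_in_Ck (component z) f" unfolding dense_in_Ck_iff using sub by blast
  show "infinite ?PP"
  proof
    assume fin: "finite ?PP"
    have "\<exists>x0\<in>Ck f. x0 \<notin> component z"
    proof (rule ccontr)
      assume "\<not> (\<exists>x0\<in>Ck f. x0 \<notin> component z)"
      then have all: "x \<in> component z" if "x \<in> Ck f" for x using that by blast
      obtain g where g: "g \<in> z" using zO unfolding Omega_def complete_fms_def by blast
      obtain y y' where y: "y \<in> C1" "y' \<in> C2"
        using dense_meets(1)[OF z(1) g] dense_meets(2)[OF z(1) g] by blast
      have "component y = component y'"
        using component_eq[OF all[OF cells_Ck(1)[OF y(1)]]] component_eq[OF all[OF cells_Ck(2)[OF y(2)]]]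
        by simp
      then show False using component_neq[OF y] by simp
    qed
    then obtain x0 where x0: "x0 \<in> Ck f" "x0 \<notin> component z" by blast
    have x0O: "x0 \<in> Omega" using Ck_Omega[OF x0(1)] .
    \<comment> \<open>\<open>P\<close> lies in a cell that misses \<open>x0\<close>, so some
      \<open>K j k\<close> has different truth values on \<open>P\<close>, where it is constant, and
      at \<open>x0\<close>.\<close>
    have "\<exists>g. g \<in> x0 \<and> (\<forall>y\<in>P. g \<notin> y)" if P: "P \<in> ?PP" for P
    proof -
      obtain j where "P \<in> Q j" using P unfolding possibility_set_def by blast
      then obtain a where a: "a \<in> Omega" "P = {y. sim j a y}" unfolding Q_eq by blast
      then have "a \<in> component z" using P sim_refl[OF a(1)] by blast
      from component_sim[OF this, of j x0] have "\<not> sim j a x0" using x0(2) by blast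
      then have "{g. K j g \<in> a} \<noteq> {g. K j g \<in> x0}" using a(1) x0O by (simp add: sim_def)
      then obtain k where k: "K j k \<in> a \<longleftrightarrow> K j k \<notin> x0" by blast
      have yk: "K j k \<in> y \<longleftrightarrow> K j k \<in> a" if "y \<in> P" for y using sim_K_iff[of j a y k] that a(2) by simp
      have yO: "y \<in> Omega" if "y \<in> P" for y using sim_Omega(2)[of j a y] that a(2) by simp
      show ?thesis
      proof (cases "K j k \<in> x0")
        case True
        then show ?thesis using yk k by blast
      next
        case False
        then have "Neg (K j k) \<in> x0" using Omega_Neg_iff[OF x0O] by blast
        moreover have "Neg (K j k) \<notin> y" if "y \<in> P" for y
          using yk[OF that] k False Omega_Neg_iff[OF yO[OF that], of "K j k"] by simp
        ultimately show ?thesis by blast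
      qed
    qed
    then have "\<forall>P\<in>?PP. \<exists>g. g \<in> x0 \<and> (\<forall>y\<in>P. g \<notin> y)" by (rule ballI)
    from bchoice[OF this] obtain G' where "\<forall>P\<in>?PP. G' P \<in> x0 \<and> (\<forall>y\<in>P. G' P \<notin> y)" ..
    then have G': "\<And>P. P \<in> ?PP \<Longrightarrow> G' P \<in> x0" "\<And>P y. P \<in> ?PP \<Longrightarrow> y \<in> P \<Longrightarrow> G' P \<notin> y"
      by simp_all
    have "finite (G' ` ?PP)" using fin by simp
    from finite_conjunction[OF this] obtain c where c: "\<forall>x\<in>Omega. c \<in> x \<longleftrightarrow> G' ` ?PP \<subseteq> x" ..
    have "G' ` ?PP \<subseteq> x0" by (rule image_subsetI) (rule G'(1))
    then have "c \<in> x0" using c x0O by simp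
    then obtain u where "u \<in> component z" "c \<in> u" using meets'[OF x0(1)] by blast
    then obtain w where "agent_path w z u" unfolding component_def by blast
    then obtain w' y where y: "agent_path w' z y" "c \<in> y" "generic y" "y \<in> Ck f"
      using generic_walk[OF _ z \<open>c \<in> u\<close>] by blast
    have yC: "y \<in> component z" using y(1) unfolding component_def by blast
    have yO: "y \<in> Omega" using Ck_Omega[OF y(4)] .
    \<comment> \<open>\<open>undefined\<close> is an arbitrary agent: all possibility sets of a
      generic point of \<open>Ck f\<close> are uncountable.\<close>
    let ?P = "{v. sim undefined y v}"
    have "?P \<in> Q undefined" unfolding Q_eq using yO by blast
    then have "possibility_set ?P" unfolding possibility_set_def by blast
    moreover have "?P \<subseteq> component z" by (rule subsetI) (simp add: component_sim[OF yC])
    ultimately have PP: "?P \<in> ?PP" using generic_possibility_set_continuum[OF y(4,3)] by simp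
    have "G' ?P \<notin> y" using G'(2)[OF PP] sim_refl[OF yO] by simp
    moreover have "G' ` ?PP \<subseteq> y" using c yO y(2) by simp
    then have "G' ?P \<in> y" using imageI[OF PP] by (rule subsetD)
    ultimately show False by blast
  qed
qed

lemma continuum_of_cells:
  "{C. cell C \<and> dense_in_Ck C f \<and>
      infinite {P. possibility_set P \<and> P \<subseteq> C \<and> P \<approx> (UNIV :: real set)}} \<approx> (UNIV :: real set)"
  (is "?CC \<approx> _")
proof -
  let ?X = "Ck f"
  \<comment> \<open>The sum type merges both countable families of conditions into one
    sequence.\<close>
  define D :: "nat \<Rightarrow> ('x, 'j) fm set set" where
    "D n = (case from_nat n of Inl (w, j, g) \<Rightarrow> generic_cond w j g | Inr g \<Rightarrow> meets_component f g)" for n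
  have D: "fm_open ?X (D n)" "fm_dense ?X (D n)" for n
    using generic_cond_open_dense meets_component_open meets_component_dense
    by (simp_all add: D_def split: sum.split prod.split)
  have generic: "generic z" "z \<in> meets_component f g" if "\<And>n. z \<in> D n" for z g
  proof -
    have "z \<in> generic_cond w j h" for w j h
      using that[of "to_nat (Inl (w, j, h) :: (('j \<times> ('x, 'j) fm) list \<times> 'j \<times> ('x, 'j) fm) + ('x, 'j) fm)"]
      by (simp add: D_def)
    then show "generic z" by (simp add: generic_def)
    show "z \<in> meets_component f g"
      using that[of "to_nat (Inr g :: (('j \<times> ('x, 'j) fm) list \<times> 'j \<times> ('x, 'j) fm) + ('x, 'j) fm)"]
      by (simp add: D_def)
  qed
  \<comment> \<open>Every word occurs as some \<open>from_nat n\<close>, so branches unrelated for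
    all \<open>n\<close> end in different cells.\<close>
  let ?R = "\<lambda>n. agent_path (from_nat n :: 'j list)"
  have closed: "\<exists>h\<in>x. \<exists>h'\<in>x'. \<forall>u\<in>?X. \<forall>u'\<in>?X. h \<in> u \<longrightarrow> h' \<in> u' \<longrightarrow> \<not> ?R n u u'"
    if x: "x \<in> ?X" "x' \<in> ?X" "\<not> ?R n x x'" for n x x'
  proof -
    obtain h where h: "h \<in> x'" "foldr K (from_nat n) (Neg h) \<in> x"
      using agent_path_closed[OF Ck_Omega[OF x(1)] Ck_Omega[OF x(2)] x(3)] by blast
    have "\<not> ?R n u u'" if u: "u \<in> ?X" "u' \<in> ?X" "foldr K (from_nat n) (Neg h) \<in> u" "h \<in> u'" for u u'
    proof
      assume "?R n u u'"
      then have "Neg h \<in> u'" using foldr_K_mem_iff[OF Ck_Omega[OF u(1)]] u(3) by blast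
      then show False using Omega_Neg_iff[OF Ck_Omega[OF u(2)]] u(4) by blast
    qed
    then show ?thesis using h by blast
  qed
  have unrelated: "\<exists>z\<in>?X. \<exists>z'\<in>?X. g \<in> z \<and> g' \<in> z' \<and> \<not> ?R n z z'"
    if y: "y \<in> ?X" "y' \<in> ?X" "g \<in> y" "g' \<in> y'" for n y y' g g'
  proof -
    obtain z z' where z: "z \<in> C1" "g \<in> z" "z' \<in> C2" "g' \<in> z'"
      using dense_meets(1)[OF y(1,3)] dense_meets(2)[OF y(2,4)] by blast
    have "\<not> ?R n z z'"
    proof
      assume "?R n z z'"
      then have "z' \<in> component z" unfolding component_def by blast
      then show False using component_eq[of z' z] component_neq[OF z(1,3)] by simp
    qed
    then show ?thesis using z cells_Ck by blast
  qed
  obtain z0 where "z0 \<in> C1" using cells(1) unfolding cell_def by blast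
  then have z0: "z0 \<in> ?X" by (rule cells_Ck(1))
  have "?CC \<subseteq> component ` Omega" using cell_iff_component by blast
  then have "?CC \<lesssim> (Omega :: ('x, 'j) fm set set)"
    by (rule lepoll_trans[OF subset_imp_lepoll image_lepoll])
  then have upper: "?CC \<lesssim> (UNIV :: real set)" by (rule lepoll_trans[OF _ fm_sets_lepoll_reals])
  show ?thesis
  proof (rule cantor_scheme_fm[where D = D and R = ?R, OF fm_compact_Ck z0 D closed unrelated])
    fix \<phi> :: "(nat \<Rightarrow> bool) \<Rightarrow> ('x, 'j) fm set"
    assume \<phi>: "\<And>\<alpha>. \<phi> \<alpha> \<in> ?X" "\<And>\<alpha> n. \<phi> \<alpha> \<in> D n" "\<And>\<alpha> \<beta> n. \<alpha> \<noteq> \<beta> \<Longrightarrow> \<not> ?R n (\<phi> \<alpha>) (\<phi> \<beta>)"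
    show ?thesis
    proof (rule eqpoll_realsI[of "\<lambda>\<alpha>. component (\<phi> \<alpha>)"])
      show "component (\<phi> \<alpha>) \<in> ?CC" for \<alpha>
        using generic_component[OF \<phi>(1) generic(1)[OF \<phi>(2)] generic(2)[OF \<phi>(2)]] by simp
      show "component (\<phi> \<alpha>) \<noteq> component (\<phi> \<beta>)" if neq: "\<alpha> \<noteq> \<beta>" for \<alpha> \<beta>
      proof
        assume "component (\<phi> \<alpha>) = component (\<phi> \<beta>)"
        then have "\<phi> \<beta> \<in> component (\<phi> \<alpha>)" using component_refl[OF Ck_Omega[OF \<phi>(1)]] by simp
        then obtain w where "agent_path w (\<phi> \<alpha>) (\<phi> \<beta>)" unfolding component_def by blast
        then show False using \<phi>(3)[OF neq, of "to_nat w"] by simp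
      qed
    qed (rule upper)
  qed
qed

end

theorem theorem1:
  fixes f :: "('x::finite, 'j::finite) fm"
  assumes "generative f"
  shows "{C. cell C \<and> dense_in_Ck C f \<and>
           infinite {P. possibility_set P \<and> P \<subseteq> C \<and> P \<approx> (UNIV :: real set)}}
         \<approx> (UNIV :: real set)"
proof -
  obtain C1 C2 where "several_dense_cells f C1 C2"
    using assms unfolding generative_def several_dense_cells_def by blast
  then show ?thesis by (rule several_dense_cells.continuum_of_cells)
qed

end
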